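(* Let $(N,B,L)$ be a Hadamard triple in $\mathbb{R}$ with $\#B<N$. For any $k\in\mathbb{N}$ and any integers $p_1,p_2,\ldots,p_k\ge 2$ with $\gcd(p_1p_2\cdots p_k,N)=1$, there exists $\Lambda\subset\mathbb{R}$ such that for all tuples $(n_1,n_2,\ldots,n_k)\in\mathbb{N}_0^k$ the set $$p_1^{n_1}p_2^{n_2}\cdots p_k^{n_k}\Lambda$$ is a spectrum of the self-similar measure $\mu_{N,B}$.
   Context: $\mathbb{N}=\{1,2,3,\ldots\}$, $\mathbb{N}_0=\mathbb{N}\cup\{0\}$, and $\#$ denotes cardinality. Hadamard triple: let $N\ge 2$ be an integer and let $B,L\subset\mathbb{Z}$ be finite sets with $\#B=\#L\ge 2$; $(N,B,L)$ is a Hadamard triple in $\mathbb{R}$ if the matrix $M=\Big(\frac{1}{\sqrt{\#B}}e^{2\pi\mathrm{i}\frac{b\ell}{N}}\Big)_{b\in B,\ \ell\in L}$ is unitary, i.e. $M^*M=I$. The self-similar measure $\mu_{N,B}$ is the unique Borel probability measure $\mu$ on $\mathbb{R}$ satisfying $\mu=\frac{1}{\#B}\sum_{b\in B}\mu\circ\tau_b^{-1}$, where $\tau_b(x)=(x+b)/N$. Spectrum: for a Borel probability measure $\mu$ on $\mathbb{R}$, a set $\Lambda\subset\mathbb{R}$ is a spectrum of $\mu$ if $\{e^{2\pi\mathrm{i}\lambda x}:\lambda\in\Lambda\}$ forms an orthonormal basis of $L^2(\mu)$. For $t\in\mathbb{R}$, $t\Lambda=\{t\lambda:\lambda\in\Lambda\}$.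 *)

theory Defs
  imports "HOL-Probability.Probability"
begin

definition hadamard_matrix :: "int \<Rightarrow> int set \<Rightarrow> int \<Rightarrow> int \<Rightarrow> complex" where
  "hadamard_matrix N B b l =
     complex_of_real (1 / sqrt (real (card B))) *
     exp (2 * complex_of_real pi * \<i> * (of_int b * of_int l / of_int N))"

text \<open>The last conjunct is \<open>M\<^sup>* M = I\<close> entrywise, for the matrix \<open>M\<close> with rows indexed by
  \<open>B\<close> and columns indexed by \<open>L\<close>.\<close>

definition hadamard_triple :: "int \<Rightarrow> int set \<Rightarrow> int set \<Rightarrow> bool" where
  "hadamard_triple N B L \<longleftrightarrow>
     N \<ge> 2 \<and> finite B \<and> finite L \<and> card B = card L \<and> card B \<ge> 2 \<and>
     (\<forall>l\<in>L. \<forall>l'\<in>L.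
        (\<Sum>b\<in>B. cnj (hadamard_matrix N B b l) * hadamard_matrix N B b l') =
        (if l = l' then 1 else 0))"

definition ifs_map :: "int \<Rightarrow> int \<Rightarrow> real \<Rightarrow> real" where
  "ifs_map N b x = (x + of_int b) / of_int N"

text \<open>The image measure \<open>\<mu> \<circ> \<tau>\<^sub>b\<^sup>-\<^sup>1\<close> is \<open>distr \<mu> borel (ifs_map N b)\<close>.\<close>

definition is_self_similar_measure :: "int \<Rightarrow> int set \<Rightarrow> real measure \<Rightarrow> bool" where
  "is_self_similar_measure N B \<mu> \<longleftrightarrow>
     prob_space \<mu> \<and> sets \<mu> = sets borel \<and>
     (\<forall>A\<in>sets borel.
        measure \<mu> A =
        1 / real (card B) * (\<Sum>b\<in>B. measure (distr \<mu> borel (ifs_map N b)) A))"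

text \<open>By Hutchinson's theorem the description below determines a unique measure whenever
  \<open>N \<ge> 2\<close> and \<open>B\<close> is finite and nonempty.\<close>

definition self_similar_measure :: "int \<Rightarrow> int set \<Rightarrow> real measure" where
  "self_similar_measure N B = (THE \<mu>. is_self_similar_measure N B \<mu>)"

text \<open>Elements of \<open>L\<^sup>2(\<mu>)\<close> are represented by functions, not by classes modulo null sets.\<close>

definition L2_functions :: "'a measure \<Rightarrow> ('a \<Rightarrow> complex) set" where
  "L2_functions \<mu> = {f \<in> borel_measurable \<mu>. integrable \<mu> (\<lambda>x. (cmod (f x))\<^sup>2)}"

definition L2_inner :: "'a measure \<Rightarrow> ('a \<Rightarrow> complex) \<Rightarrow> ('a \<Rightarrow> complex) \<Rightarrow> complex" where
  "L2_inner \<mu> f g = (LINT x|\<mu>. f x * cnj (g x))"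

definition L2_norm :: "'a measure \<Rightarrow> ('a \<Rightarrow> complex) \<Rightarrow> real" where
  "L2_norm \<mu> f = sqrt (LINT x|\<mu>. (cmod (f x))\<^sup>2)"

text \<open>An orthonormal basis is an orthonormal set whose linear span is dense in \<open>L\<^sup>2(\<mu>)\<close>. Distinct
  functions in \<open>S\<close> are required to be orthogonal even if they agree almost everywhere, so such
  functions cannot both belong to \<open>S\<close>.\<close>

definition L2_orthonormal_basis :: "'a measure \<Rightarrow> ('a \<Rightarrow> complex) set \<Rightarrow> bool" where
  "L2_orthonormal_basis \<mu> S \<longleftrightarrow>
     S \<subseteq> L2_functions \<mu> \<and>
     (\<forall>f\<in>S. \<forall>g\<in>S. L2_inner \<mu> f g = (if f = g then 1 else 0)) \<and>
     (\<forall>f\<in>L2_functions \<mu>. \<forall>\<epsilon>>0. \<exists>F c. finite F \<and> F \<subseteq> S \<and>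
        L2_norm \<mu> (\<lambda>x. f x - (\<Sum>g\<in>F. c g * g x)) < \<epsilon>)"

definition exponential :: "real \<Rightarrow> real \<Rightarrow> complex" where
  "exponential t x = exp (2 * complex_of_real pi * \<i> * complex_of_real t * complex_of_real x)"

definition is_spectrum :: "real measure \<Rightarrow> real set \<Rightarrow> bool" where
  "is_spectrum \<mu> \<Lambda> \<longleftrightarrow> L2_orthonormal_basis \<mu> (exponential ` \<Lambda>)"

end

theory Submission
  imports Defs
    "HOL-Computational_Algebra.Primes"
    "HOL-Complex_Analysis.Conformal_Mappings"
begin

text \<open>
The spectrum is built as an increasing union of finite sets \<open>\<Gamma>\<^sub>j\<close> of integers, each of which is a spectrum
of the distribution \<open>\<mu>\<^sub>n\<close> of a truncated \<open>N\<close>-adic expansion \<open>\<Sum>i<n. b\<^sub>i / N ^ (i + 1)\<close> with random digits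
\<open>b\<^sub>i \<in> B\<close>, for a level \<open>n = n\<^sub>j\<close> that grows with \<open>j\<close>. A multiplier \<open>u\<close> prime to \<open>N\<close> does not destroy this:
\<open>(N, B, u L)\<close> is again a Hadamard triple, because vanishing sums of \<open>N\<close>-th roots of unity are stable under
\<open>\<zeta> \<mapsto> \<zeta>\<^sup>u\<close> (\<open>vanishing_root_of_unity_sum_power\<close>). So \<open>u \<Gamma>\<^sub>j\<close> is a spectrum of \<open>\<mu>\<^sub>n\<close> for all such \<open>u\<close>
at once, and the exponentials with frequencies in the union, multiplied by \<open>u\<close>, are orthogonal in
\<open>L\<^sup>2(\<mu>)\<close>.

Completeness can fail in the limit, as mass may escape to infinity. The Fourier transform of \<open>\<mu>\<close> at \<open>t\<close> is
that of \<open>\<mu>\<^sub>n\<close> at \<open>t\<close> times that of \<open>\<mu>\<close> at \<open>t / N ^ n\<close>. No mass is lost for the multiplier \<open>u\<close> if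
the second factor stays bounded away from \<open>0\<close> at the points of \<open>u \<Gamma>\<^sub>j\<close>, and it is enough that this happens for
infinitely many \<open>j\<close> (\<open>exists_simultaneous_parseval_set\<close>). Now the elements of \<open>\<Gamma>\<^sub>j\<close> may be moved freely
in their classes modulo \<open>N ^ n\<close>, so for a given \<open>u\<close> the bound can be achieved provided that the Fourier
transform does not vanish on an entire coset \<open>x + u \<int>\<close>. This is where \<open>card B < N\<close> enters: the set of the
\<open>x\<close> with an entire coset of zeros is finite modulo \<open>u\<close>, and under multiplication by \<open>N\<close> each of its points would
have at least two preimages in it, so it is empty (\<open>exists_ft_nonzero_on_coset\<close>).

There are countably many multipliers, and each step of the construction serves one of them. A sequence that
returns to each multiplier infinitely often serves all of them with the same union (\<open>exists_tower\<close>).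
\<close>

section \<open>Vanishing sums of roots of unity\<close>

text \<open>The ring \<open>\<int>[\<zeta>]\<close> generated by a primitive \<open>N\<close>-th root of unity \<open>\<zeta>\<close>. Generating it by multiplication with
arbitrary \<open>N\<close>-th roots of unity avoids the choice of \<open>\<zeta>\<close> and makes an induction on membership carry a
free root of unity along.\<close>

inductive_set cyclotomic_ring :: "nat \<Rightarrow> complex set" for N :: nat where
  one: "1 \<in> cyclotomic_ring N"
| root: "w ^ N = 1 \<Longrightarrow> x \<in> cyclotomic_ring N \<Longrightarrow> w * x \<in> cyclotomic_ring N"
| add: "x \<in> cyclotomic_ring N \<Longrightarrow> y \<in> cyclotomic_ring N \<Longrightarrow> x + y \<in> cyclotomic_ring N"
| uminus: "x \<in> cyclotomic_ring N \<Longrightarrow> - x \<in> cyclotomic_ring N"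

lemma cyclotomic_ring_zero: "0 \<in> cyclotomic_ring N"
  using cyclotomic_ring.add[OF cyclotomic_ring.one cyclotomic_ring.uminus[OF cyclotomic_ring.one]]
  by simp

lemma cyclotomic_ring_mult:
  assumes "x \<in> cyclotomic_ring N" "y \<in> cyclotomic_ring N"
  shows "x * y \<in> cyclotomic_ring N"
  using assms(1)
proof induction
  case one
  then show ?case using assms(2) by simp
next
  case (root w x)
  then show ?case by (simp add: cyclotomic_ring.root mult.assoc)
next
  case (add x z)
  then show ?case by (simp add: cyclotomic_ring.add distrib_right)
next
  case (uminus x)
  then show ?case using cyclotomic_ring.uminus by fastforce
qed

lemma cyclotomic_ring_power: "x \<in> cyclotomic_ring N \<Longrightarrow> x ^ k \<in> cyclotomic_ring N"
  by (induction k) (auto intro: cyclotomic_ring.one cyclotomic_ring_mult)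

lemma cyclotomic_ring_of_nat: "of_nat k \<in> cyclotomic_ring N"
  by (induction k) (auto intro: cyclotomic_ring_zero cyclotomic_ring.add cyclotomic_ring.one)

lemma cyclotomic_ring_sum:
  "(\<And>i. i \<in> A \<Longrightarrow> f i \<in> cyclotomic_ring N) \<Longrightarrow> (\<Sum>i\<in>A. f i) \<in> cyclotomic_ring N"
  by (induction A rule: infinite_finite_induct) (auto intro: cyclotomic_ring_zero cyclotomic_ring.add)

text \<open>Modulo a prime \<open>q\<close> the Frobenius map is additive: the inner binomial coefficients are divisible
by \<open>q\<close>.\<close>

lemma frobenius_add:
  assumes "prime q" "x \<in> cyclotomic_ring N" "y \<in> cyclotomic_ring N"
  shows "\<exists>r\<in>cyclotomic_ring N. (x + y) ^ q = x ^ q + y ^ q + of_nat q * r"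
proof -
  have q: "q > 0" using assms(1) prime_gt_0_nat by blast
  define r where "r = (\<Sum>k\<in>{1..<q}. of_nat ((q choose k) div q) * (x ^ k * y ^ (q - k)))"
  have "r \<in> cyclotomic_ring N"
    unfolding r_def
    by (intro cyclotomic_ring_sum cyclotomic_ring_mult cyclotomic_ring_of_nat cyclotomic_ring_power assms)
  have ch: "of_nat (q choose k) = (of_nat q * of_nat ((q choose k) div q) :: complex)"
    if "k \<in> {1..<q}" for k
  proof -
    have "q dvd (q choose k)"
      using that assms(1) by (intro dvd_choose_prime) auto
    then show ?thesis
      by (metis dvd_mult_div_cancel of_nat_mult)
  qed
  have "{..q} = insert 0 (insert q {1..<q})" using q by auto
  then have "(x + y) ^ q = y ^ q + (x ^ q + (\<Sum>k\<in>{1..<q}. of_nat (q choose k) * x ^ k * y ^ (q - k)))"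
    unfolding binomial_ring using q by simp
  also have "(\<Sum>k\<in>{1..<q}. of_nat (q choose k) * x ^ k * y ^ (q - k)) = of_nat q * r"
    unfolding r_def sum_distrib_left by (intro sum.cong refl) (simp add: ch mult.assoc)
  finally show ?thesis using \<open>r \<in> _\<close> by (intro bexI[of _ r]) auto
qed

lemma frobenius_sum:
  assumes "prime q" "finite B" "\<And>b. b \<in> B \<Longrightarrow> x b \<in> cyclotomic_ring N"
  shows "\<exists>r\<in>cyclotomic_ring N. (\<Sum>b\<in>B. x b) ^ q = (\<Sum>b\<in>B. x b ^ q) + of_nat q * r"
  using assms(2,3)
proof (induction B rule: finite_induct)
  case empty
  then show ?case using prime_gt_0_nat[OF assms(1)] cyclotomic_ring_zero by (intro bexI[of _ 0]) auto
next
  case (insert b B)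
  obtain r where r: "r \<in> cyclotomic_ring N" "(\<Sum>b\<in>B. x b) ^ q = (\<Sum>b\<in>B. x b ^ q) + of_nat q * r"
    using insert by auto
  obtain s where s: "s \<in> cyclotomic_ring N"
    "(x b + (\<Sum>b\<in>B. x b)) ^ q = x b ^ q + (\<Sum>b\<in>B. x b) ^ q + of_nat q * s"
    using frobenius_add[OF assms(1), of "x b" N "\<Sum>b\<in>B. x b"] insert.prems
    by (auto intro: cyclotomic_ring_sum)
  show ?case
  proof (rule bexI)
    show "(\<Sum>b\<in>insert b B. x b) ^ q = (\<Sum>b\<in>insert b B. x b ^ q) + of_nat q * (r + s)"
      using insert.hyps r(2) s(2) by (simp add: distrib_left)
    show "r + s \<in> cyclotomic_ring N"
      using r(1) s(1) by (rule cyclotomic_ring.add)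
  qed
qed

text \<open>The complex numbers and the rationals as vector spaces over the rationals.\<close>

interpretation rat_complex: vector_space_pair
  "\<lambda>(q::rat) (z::complex). of_rat q * z" "\<lambda>(q::rat) (z::rat). q * z"
  by unfold_locales (auto simp: algebra_simps of_rat_add of_rat_mult)

text \<open>A nonzero number is divisible in \<open>\<int>[\<zeta>]\<close> by only finitely many integers. Choose a rational linear
functional \<open>\<phi>\<close> on the complex numbers with \<open>\<phi> \<gamma> = 1\<close>. Clearing the denominators of its values at the
finitely many \<open>N\<close>-th roots of unity gives \<open>D\<close> such that \<open>D \<phi>\<close> is integral on the whole ring, so
\<open>\<gamma> = q \<beta>\<close> yields \<open>D = q (D \<phi> \<beta>)\<close> and thus \<open>q \<le> D\<close>.\<close>

lemma cyclotomic_ring_finitely_many_divisors: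
  assumes "N > 0" "\<gamma> \<noteq> 0"
  shows "\<exists>D. \<forall>q>D. \<forall>\<beta>\<in>cyclotomic_ring N. \<gamma> \<noteq> of_nat q * \<beta>"
proof -
  have "rat_complex.vs1.independent {\<gamma>}"
    using assms(2) by (simp add: rat_complex.vs1.independent_insert)
  then obtain \<phi> where lin: "Vector_Spaces.linear (\<lambda>(q::rat) (z::complex). of_rat q * z) (\<lambda>q z. q * z) \<phi>"
    and \<phi>: "\<phi> \<gamma> = 1"
    using rat_complex.linear_independent_extend[of "{\<gamma>}" "\<lambda>_. 1"] by auto
  interpret \<phi>: Vector_Spaces.linear "\<lambda>(q::rat) (z::complex). of_rat q * z" "\<lambda>q z. q * z" \<phi>
    by (rule lin)
  define W where "W = {w::complex. w ^ N = 1}"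
  have finW: "finite W"
    unfolding W_def using assms(1) finite_roots_unity by (metis One_nat_def Suc_leI)
  define D where "D = (\<Prod>w\<in>W. snd (quotient_of (\<phi> w)))"
  have Dpos: "D > 0"
    unfolding D_def by (intro prod_pos) (auto intro: quotient_of_denom_pos')
  have base: "of_int D * \<phi> w \<in> \<int>" if "w \<in> W" for w
  proof -
    define n d where "n = fst (quotient_of (\<phi> w))" and "d = snd (quotient_of (\<phi> w))"
    have "\<phi> w = of_int n / of_int d" "d > 0"
      using quotient_of_div[of "\<phi> w" n d] quotient_of_denom_pos'[of "\<phi> w"] by (auto simp: n_def d_def)
    moreover have "D = d * (\<Prod>w\<in>W - {w}. snd (quotient_of (\<phi> w)))"
      unfolding D_def d_def using finW that by (simp add: prod.remove)
    ultimately show ?thesis by (auto intro!: Ints_mult Ints_prod)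
  qed
  have int: "of_int D * \<phi> (w * \<beta>) \<in> \<int>" if "\<beta> \<in> cyclotomic_ring N" "w \<in> W" for w \<beta>
    using that
  proof (induction arbitrary: w)
    case one
    then show ?case using base by simp
  next
    case (root v x)
    have "w * v \<in> W" using root by (auto simp: W_def power_mult_distrib)
    from root.IH[OF this] show ?case by (simp add: mult.assoc)
  next
    case (add x y)
    then show ?case by (simp add: distrib_left \<phi>.add)
  next
    case (uminus x)
    then show ?case by (simp add: \<phi>.neg)
  qed
  show ?thesis
  proof (intro exI[of _ "nat D"] allI impI ballI notI)
    fix q \<beta> assume q: "q > nat D" and \<beta>: "\<beta> \<in> cyclotomic_ring N" "\<gamma> = of_nat q * \<beta>"
    have "1 = \<phi> (of_rat (of_nat q) * \<beta>)" using \<phi> \<beta> by simp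
    also have "\<dots> = of_nat q * \<phi> \<beta>" by (rule \<phi>.scale)
    finally have 1: "of_nat q * \<phi> \<beta> = 1" by simp
    obtain k where k: "of_int D * \<phi> \<beta> = of_int k"
      using int[OF \<beta>(1), of 1] by (auto simp: W_def elim: Ints_cases)
    have "of_int D = of_nat q * (of_int D * \<phi> \<beta>)" using 1 by (simp add: algebra_simps)
    then have "(of_int D :: rat) = of_int (int q * k)" using k by simp
    then have "D = int q * k" by (simp only: of_int_eq_iff)
    then have "int q dvd D" by simp
    then have "int q \<le> D" using Dpos zdvd_imp_le by blast
    then show False using q by simp
  qed
qed

text \<open>Every residue class of units modulo \<open>N\<close> contains a number without small prime factors. Take for \<open>t\<close>
the product of the primes up to \<open>X\<close> that do not divide \<open>u\<close>. A prime up to \<open>X\<close> then divides exactly one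
of the two summands \<open>u\<close> and \<open>N t\<close>, hence not their sum.\<close>

lemma exists_congruent_without_small_prime_factors:
  fixes u N X :: nat
  assumes "coprime u N"
  shows "\<exists>t. \<forall>q. prime q \<and> q dvd u + N * t \<longrightarrow> q > X"
proof -
  define t where "t = (\<Prod>q\<in>{q. prime q \<and> q \<le> X \<and> \<not> q dvd u}. q)"
  have fin: "finite {q. prime q \<and> q \<le> X \<and> \<not> q dvd u}" by (rule finite_subset[of _ "{..X}"]) auto
  have "q > X" if q: "prime q" "q dvd u + N * t" for q
  proof (rule ccontr)
    assume "\<not> q > X"
    then have qX: "q \<le> X" by simp
    show False
    proof (cases "q dvd u")
      case True
      then have "q dvd N * t" using q(2) by (simp add: dvd_add_right_iff)
      moreover have "\<not> q dvd N" using True assms q(1) by (meson coprime_common_divisor not_prime_unit)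
      ultimately have "q dvd t" using prime_dvd_multD[OF q(1)] by blast
      then obtain r where "r \<in> {q. prime q \<and> q \<le> X \<and> \<not> q dvd u}" "q dvd r"
        unfolding t_def using prime_dvd_prod_iff[OF fin q(1)] by auto
      then have "q = r" using q(1) by (auto intro: primes_dvd_imp_eq)
      then show False using True \<open>r \<in> _\<close> by auto
    next
      case False
      then have "q dvd t" unfolding t_def using fin q(1) qX by (intro dvd_prodI) auto
      then have "q dvd u" using q(2) by (simp add: dvd_add_left_iff)
      then show False using False by simp
    qed
  qed
  then show ?thesis by blast
qed

text \<open>This is the action of the Galois group of the \<open>N\<close>-th cyclotomic field on vanishing sums of roots of
unity, proved without the irreducibility of the cyclotomic polynomial. Write \<open>S j\<close> for the sum of the
\<open>j\<close>-th powers; it depends only on \<open>j\<close> modulo \<open>N\<close>. If \<open>S j = 0\<close> and \<open>q\<close> is prime, then \<open>S (q j)\<close> is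
congruent to \<open>S j ^ q = 0\<close> modulo \<open>q\<close>. Since \<open>S\<close> has only finitely many values, and none of the
nonzero ones is divisible by a large prime, \<open>S (q j) = 0\<close> for all large primes \<open>q\<close>. Finally \<open>u\<close> is
congruent modulo \<open>N\<close> to a product of large primes.\<close>

theorem vanishing_root_of_unity_sum_power:
  fixes x :: "'a \<Rightarrow> complex"
  assumes N: "N > 0" and B: "finite B" "\<And>b. b \<in> B \<Longrightarrow> x b ^ N = 1"
    and sum0: "(\<Sum>b\<in>B. x b) = 0" and u: "coprime u N"
  shows "(\<Sum>b\<in>B. x b ^ u) = 0"
proof -
  define S where "S j = (\<Sum>b\<in>B. x b ^ j)" for j
  have Sper: "S (j + N * t) = S j" for j t
    unfolding S_def using B by (intro sum.cong) (auto simp: power_add power_mult)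
  then have Smod: "S (j mod N) = S j" for j
    by (metis mod_mult_div_eq)
  have "\<forall>j. \<exists>D. S j \<noteq> 0 \<longrightarrow> (\<forall>q>D. \<forall>\<beta>\<in>cyclotomic_ring N. S j \<noteq> of_nat q * \<beta>)"
    using cyclotomic_ring_finitely_many_divisors[OF N] by metis
  then obtain D where D: "\<And>j q \<beta>. S j \<noteq> 0 \<Longrightarrow> q > D j \<Longrightarrow> \<beta> \<in> cyclotomic_ring N \<Longrightarrow> S j \<noteq> of_nat q * \<beta>"
    by metis
  define X where "X = (\<Sum>j<N. D j)"
  have X: "D (j mod N) \<le> X" for j
    unfolding X_def using N by (intro member_le_sum) auto
  have step: "S (q * j) = 0" if q: "prime q" "q > X" and j: "S j = 0" for q j
  proof (rule ccontr)
    assume "S (q * j) \<noteq> 0"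
    then have nz: "S (q * j mod N) \<noteq> 0" by (simp add: Smod)
    have "x b ^ j \<in> cyclotomic_ring N" if "b \<in> B" for b
    proof -
      have "(x b ^ j) ^ N = (x b ^ N) ^ j" by (simp add: power_mult[symmetric] mult.commute)
      then have "(x b ^ j) ^ N = 1" using B(2)[OF that] by simp
      from cyclotomic_ring.root[OF this cyclotomic_ring.one] show ?thesis by simp
    qed
    from frobenius_sum[OF q(1) B(1), of "\<lambda>b. x b ^ j", OF this]
    obtain r where r: "r \<in> cyclotomic_ring N" "S j ^ q = (\<Sum>b\<in>B. (x b ^ j) ^ q) + of_nat q * r"
      unfolding S_def by blast
    have "(\<Sum>b\<in>B. (x b ^ j) ^ q) = S (q * j)"
      unfolding S_def by (simp add: power_mult[symmetric] mult.commute)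
    then have "S (q * j) = of_nat q * (- r)"
      using r(2) j prime_gt_0_nat[OF q(1)] by (simp add: eq_neg_iff_add_eq_0 zero_power)
    then have "S (q * j mod N) = of_nat q * (- r)" by (simp add: Smod)
    moreover have "q > D (q * j mod N)" using X[of "q * j"] q(2) by simp
    ultimately show False using D[OF nz] cyclotomic_ring.uminus[OF r(1)] by blast
  qed
  obtain t where t: "\<And>q. prime q \<Longrightarrow> q dvd u + N * t \<Longrightarrow> q > X"
    using exists_congruent_without_small_prime_factors[OF u] by blast
  have large: "S v = 0" if "v > 0" "\<And>q. prime q \<Longrightarrow> q dvd v \<Longrightarrow> q > X" for v
    using that
  proof (induction v rule: less_induct)
    case (less v)
    show ?case
    proof (cases "v = 1")
      case True
      then show ?thesis using sum0 by (simp add: S_def)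
    next
      case False
      then obtain q where q: "prime q" "q dvd v" using prime_factor_nat by blast
      then obtain w where w: "v = q * w" by blast
      have "w > 0" "w < v" using w less.prems(1) q(1) prime_gt_1_nat by auto
      then have "S w = 0" using less w by auto
      then show ?thesis using step[OF q(1) less.prems(2)[OF q]] w by simp
    qed
  qed
  show ?thesis
  proof (cases "u + N * t > 0")
    case True
    have "S (u + N * t) = 0" using t by (intro large True) auto
    then show ?thesis by (simp add: Sper) (simp add: S_def)
  next
    case False
    then have "N = 1" using u by simp
    then have "S u = S 1" using Smod by (metis mod_by_1)
    then show ?thesis using sum0 by (simp add: S_def)
  qed
qed

section \<open>Hadamard triples and their multiples\<close>

lemma exponential_add: "exponential (s + t) x = exponential s x * exponential t x"
  by (simp add: exponential_def distrib_left distrib_right exp_add)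

lemma exponential_commute: "exponential t x = exponential x t"
  by (simp add: exponential_def mult.commute mult.left_commute)

lemma exponential_add_right: "exponential t (x + y) = exponential t x * exponential t y"
  by (metis exponential_add exponential_commute)

lemma exponential_eq_cis: "exponential t x = cis (2 * pi * t * x)"
  by (simp add: exponential_def cis_conv_exp mult_ac)

lemma cnj_exponential: "cnj (exponential t x) = exponential (- t) x"
  by (simp add: exponential_eq_cis cis_cnj)

lemma exponential_diff: "exponential (s - t) x = exponential s x * cnj (exponential t x)"
  by (simp only: cnj_exponential exponential_add[symmetric] diff_conv_add_uminus)

lemma norm_exponential [simp]: "cmod (exponential t x) = 1"
  by (simp add: exponential_eq_cis)

lemma exponential_0 [simp]: "exponential 0 x = 1" "exponential t 0 = 1"
  by (simp_all add: exponential_def)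

lemma exponential_of_nat_mult: "exponential (of_nat n * t) x = exponential t x ^ n"
  by (induction n) (simp_all add: distrib_right exponential_add)

lemma exponential_int [simp]: "exponential (of_int a) (of_int b) = 1"
proof -
  have "exponential (of_int a) (of_int b) = cis (2 * pi * real_of_int (a * b))"
    by (simp add: exponential_eq_cis mult_ac)
  also have "\<dots> = 1" by (metis Ints_of_int cis_multiple_2pi)
  finally show ?thesis .
qed

text \<open>The Fourier transform of the uniform distribution on \<open>B\<close>, normalised so that \<open>mask_poly B 0 = 1\<close>.\<close>

definition mask_poly :: "int set \<Rightarrow> real \<Rightarrow> complex" where
  "mask_poly B \<xi> = (\<Sum>b\<in>B. exponential \<xi> (of_int b)) / of_nat (card B)"

lemma mask_poly_add_int [simp]: "mask_poly B (\<xi> + of_int k) = mask_poly B \<xi>"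
  by (simp add: mask_poly_def exponential_add)

lemma mask_poly_0: "finite B \<Longrightarrow> B \<noteq> {} \<Longrightarrow> mask_poly B 0 = 1"
  by (simp add: mask_poly_def)

text \<open>A square matrix with orthonormal columns has orthonormal rows. Rows and columns are indexed by
different sets, so instead of inverting a matrix the proof computes with \<open>G = M M\<^sup>*\<close>: both the trace of
\<open>G\<close> and its squared Frobenius norm equal the number of columns, so the squared Frobenius norm of
\<open>G - I\<close> is \<open>card L - 2 card L + card B = 0\<close>.\<close>

lemma unitary_rows:
  fixes M :: "'a \<Rightarrow> 'b \<Rightarrow> complex"
  assumes fin: "finite B" "finite L" and card: "card B = card L"
    and cols: "\<And>l l'. l \<in> L \<Longrightarrow> l' \<in> L \<Longrightarrow> (\<Sum>b\<in>B. cnj (M b l) * M b l') = (if l = l' then 1 else 0)"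
    and b: "b \<in> B" "b' \<in> B"
  shows "(\<Sum>l\<in>L. M b l * cnj (M b' l)) = (if b = b' then 1 else 0)"
proof -
  define G where "G b b' = (\<Sum>l\<in>L. M b l * cnj (M b' l))" for b b'
  define \<delta> where "\<delta> b b' = (if b = b' then 1 else 0 :: complex)" for b b' :: 'a
  have pick: "(\<Sum>b'\<in>B. f b' * \<delta> b b') = f b" if "b \<in> B" for f b
  proof -
    have "(\<Sum>b'\<in>B. f b' * \<delta> b b') = (\<Sum>b'\<in>B. if b = b' then f b' else 0)"
      by (intro sum.cong) (auto simp: \<delta>_def)
    then show ?thesis using fin that by simp
  qed
  have cnjG: "cnj (G b b') = G b' b" for b b'
    by (simp add: G_def mult.commute)
  have tr: "(\<Sum>b\<in>B. G b b) = of_nat (card L)"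
  proof -
    have "(\<Sum>b\<in>B. G b b) = (\<Sum>l\<in>L. \<Sum>b\<in>B. cnj (M b l) * M b l)"
      unfolding G_def by (subst sum.swap) (simp add: mult.commute)
    also have "\<dots> = of_nat (card L)" using cols by simp
    finally show ?thesis .
  qed
  have GG: "(\<Sum>b\<in>B. \<Sum>b'\<in>B. G b b' * cnj (G b b')) = of_nat (card L)"
  proof -
    have "(\<Sum>b\<in>B. \<Sum>b'\<in>B. G b b' * cnj (G b b')) =
      (\<Sum>b\<in>B. \<Sum>b'\<in>B. \<Sum>l\<in>L. \<Sum>l'\<in>L. (M b l * cnj (M b l')) * (cnj (M b' l) * M b' l'))"
      by (simp add: G_def sum_product mult_ac)
    also have "\<dots> = (\<Sum>b\<in>B. \<Sum>l\<in>L. \<Sum>l'\<in>L. \<Sum>b'\<in>B. (M b l * cnj (M b l')) * (cnj (M b' l) * M b' l'))"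
      by (rule sum.cong[OF refl], subst sum.swap, rule sum.cong[OF refl], rule sum.swap)
    also have "\<dots> = (\<Sum>b\<in>B. \<Sum>l\<in>L. \<Sum>l'\<in>L. (M b l * cnj (M b l')) * (if l = l' then 1 else 0))"
      by (simp add: sum_distrib_left[symmetric] cols cong: sum.cong)
    also have "\<dots> = (\<Sum>b\<in>B. G b b)"
      using fin by (simp add: G_def if_distrib cong: if_cong)
    finally show ?thesis using tr by simp
  qed
  have "complex_of_real (\<Sum>b\<in>B. \<Sum>b'\<in>B. (cmod (G b b' - \<delta> b b'))\<^sup>2)
      = (\<Sum>b\<in>B. \<Sum>b'\<in>B. (G b b' - \<delta> b b') * cnj (G b b' - \<delta> b b'))"
    by (simp only: of_real_sum complex_norm_square)
  also have "\<dots> = (\<Sum>b\<in>B. \<Sum>b'\<in>B. G b b' * cnj (G b b') - cnj (G b b') * \<delta> b b' - G b b' * \<delta> b b' + 1 * \<delta> b b')"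
    by (intro sum.cong refl) (auto simp: \<delta>_def algebra_simps)
  also have "\<dots> = (\<Sum>b\<in>B. \<Sum>b'\<in>B. G b b' * cnj (G b b')) - (\<Sum>b\<in>B. cnj (G b b)) - (\<Sum>b\<in>B. G b b) + of_nat (card B)"
    unfolding sum.distrib sum_subtractf by (simp only: pick sum_constant mult_1_right cong: sum.cong)
  also have "\<dots> = 0"
    using GG tr card by (simp add: cnjG)
  finally have "(\<Sum>b\<in>B. \<Sum>b'\<in>B. (cmod (G b b' - \<delta> b b'))\<^sup>2) = 0"
    by (simp only: of_real_eq_0_iff)
  then have "\<forall>b\<in>B. \<forall>b'\<in>B. (cmod (G b b' - \<delta> b b'))\<^sup>2 = 0"
    using fin by (simp add: sum_nonneg_eq_0_iff sum_nonneg)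
  then have "G b b' = \<delta> b b'" using b by simp
  then show ?thesis by (simp add: G_def \<delta>_def)
qed

locale hadamard =
  fixes N :: int and B L :: "int set"
  assumes triple: "hadamard_triple N B L"
begin

lemma N_ge2: "N \<ge> 2" and finite_B: "finite B" and finite_L: "finite L"
  and card_eq: "card B = card L" and card_ge2: "card B \<ge> 2"
  using triple by (auto simp: hadamard_triple_def)

lemma B_nonempty: "B \<noteq> {}"
  using card_ge2 by auto

lemma L_nonempty: "L \<noteq> {}"
  using card_ge2 card_eq by auto

lemma sum_exponential_L_differences:
  assumes "l \<in> L" "l' \<in> L"
  shows "(\<Sum>b\<in>B. exponential (of_int (l' - l) / of_int N) (of_int b)) = (if l = l' then of_nat (card B) else 0)"
proof -
  define r where "r = complex_of_real (1 / sqrt (real (card B)))"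
  have hm: "hadamard_matrix N B b l = r * exponential (of_int l / of_int N) (of_int b)" for b l
    by (simp add: hadamard_matrix_def exponential_def r_def mult_ac)
  have r2: "r * r = 1 / of_nat (card B)"
    unfolding r_def of_real_mult[symmetric] using card_ge2 by (simp add: real_sqrt_mult_self)
  have cr: "cnj r = r" by (simp add: r_def)
  have "(if l = l' then 1 else 0) = (\<Sum>b\<in>B. cnj (hadamard_matrix N B b l) * hadamard_matrix N B b l')"
    using triple assms by (simp add: hadamard_triple_def)
  also have "\<dots> = (\<Sum>b\<in>B. (r * r) * exponential (of_int (l' - l) / of_int N) (of_int b))"
    unfolding hm complex_cnj_mult cr
    by (intro sum.cong refl) (simp add: diff_divide_distrib exponential_diff mult_ac)
  also have "\<dots> = (r * r) * (\<Sum>b\<in>B. exponential (of_int (l' - l) / of_int N) (of_int b))"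
    by (simp add: sum_distrib_left)
  finally show ?thesis
    using card_ge2 by (auto simp: r2 split: if_splits)
qed

text \<open>Replacing \<open>L\<close> by \<open>u L\<close> with \<open>u\<close> prime to \<open>N\<close> keeps the Hadamard property, since it replaces the
\<open>N\<close>-th roots of unity in the orthogonality relations by their \<open>u\<close>-th powers.\<close>

lemma sum_exponential_multiple_L_differences:
  assumes "l \<in> L" "l' \<in> L" and u: "coprime (int u) N"
  shows "(\<Sum>b\<in>B. exponential (of_nat u * (of_int (l' - l) / of_int N)) (of_int b)) = (if l = l' then of_nat (card B) else 0)"
proof (cases "l = l'")
  case False
  have root: "exponential (of_int (l' - l) / of_int N) (of_int b) ^ nat N = 1" for b
  proof -
    have "exponential (of_int (l' - l) / of_int N) (of_int b) ^ nat N
        = exponential (of_nat (nat N) * (of_int (l' - l) / of_int N)) (of_int b)"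
      by (rule exponential_of_nat_mult[symmetric])
    also have "\<dots> = exponential (of_int (l' - l)) (of_int b)" using N_ge2 by simp
    finally show ?thesis by (simp only: exponential_int)
  qed
  have "coprime u (nat N)"
    using u N_ge2 by (metis coprime_int_iff int_nat_eq order.trans zero_le_numeral)
  then have "(\<Sum>b\<in>B. exponential (of_int (l' - l) / of_int N) (of_int b) ^ u) = 0"
    using N_ge2 finite_B root sum_exponential_L_differences[OF assms(1,2)] False
    by (intro vanishing_root_of_unity_sum_power[of "nat N"]) auto
  then show ?thesis using False by (simp only: exponential_of_nat_mult if_False)
qed simp

text \<open>Parseval's identity for the orthonormal basis of the functions on \<open>B\<close> given by \<open>u L\<close>, applied to an
exponential function.\<close>

lemma sum_norm_mask_poly_sq:
  assumes u: "coprime (int u) N"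
  shows "(\<Sum>l\<in>L. (cmod (mask_poly B (\<eta> + of_nat u * of_int l / of_int N)))\<^sup>2) = 1"
proof -
  define n where "n = card B"
  define r where "r = complex_of_real (1 / sqrt (real n))"
  have n: "n \<ge> 2" using card_ge2 by (simp add: n_def)
  have r2: "r * r = 1 / of_nat n"
    unfolding r_def of_real_mult[symmetric] using n by (simp add: real_sqrt_mult_self)
  have cr: "cnj r = r" by (simp add: r_def)
  define M where "M b l = r * exponential (of_nat u * (of_int l / of_int N)) (of_int b)" for b l :: int
  have cols: "(\<Sum>b\<in>B. cnj (M b l) * M b l') = (if l = l' then 1 else 0)" if "l \<in> L" "l' \<in> L" for l l'
  proof -
    have "cnj (M b l) * M b l' = (r * r) * exponential (of_nat u * (of_int (l' - l) / of_int N)) (of_int b)" for b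
      unfolding M_def complex_cnj_mult cr
      by (simp add: diff_divide_distrib right_diff_distrib exponential_diff mult_ac)
    then have "(\<Sum>b\<in>B. cnj (M b l) * M b l') = (r * r) * (\<Sum>b\<in>B. exponential (of_nat u * (of_int (l' - l) / of_int N)) (of_int b))"
      by (simp add: sum_distrib_left)
    then show ?thesis
      unfolding sum_exponential_multiple_L_differences[OF that u] using n by (simp add: r2 n_def)
  qed
  note rows = unitary_rows[OF finite_B finite_L card_eq cols]
  have mask_poly: "mask_poly B (\<eta> + of_nat u * of_int l / of_int N) = r * (\<Sum>b\<in>B. exponential \<eta> (of_int b) * M b l)" for l
  proof -
    have "r * (\<Sum>b\<in>B. exponential \<eta> (of_int b) * M b l)
        = (r * r) * (\<Sum>b\<in>B. exponential (\<eta> + of_nat u * of_int l / of_int N) (of_int b))"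
      by (simp add: M_def sum_distrib_left exponential_add mult_ac)
    then show ?thesis by (simp add: mask_poly_def r2 n_def)
  qed
  have "complex_of_real (\<Sum>l\<in>L. (cmod (mask_poly B (\<eta> + of_nat u * of_int l / of_int N)))\<^sup>2)
     = (\<Sum>l\<in>L. (r * (\<Sum>b\<in>B. exponential \<eta> (of_int b) * M b l)) * cnj (r * (\<Sum>b\<in>B. exponential \<eta> (of_int b) * M b l)))"
    by (simp only: of_real_sum complex_norm_square mask_poly)
  also have "\<dots> = (\<Sum>l\<in>L. (r * r) * (\<Sum>b\<in>B. \<Sum>b'\<in>B.
      exponential \<eta> (of_int b) * cnj (exponential \<eta> (of_int b')) * (M b l * cnj (M b' l))))"
    by (simp add: sum_product cr mult_ac)
  also have "\<dots> = (r * r) * (\<Sum>b\<in>B. \<Sum>l\<in>L. \<Sum>b'\<in>B.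
      exponential \<eta> (of_int b) * cnj (exponential \<eta> (of_int b')) * (M b l * cnj (M b' l)))"
    unfolding sum_distrib_left[symmetric] by (subst sum.swap) (rule refl)
  also have "\<dots> = (r * r) * (\<Sum>b\<in>B. \<Sum>b'\<in>B. \<Sum>l\<in>L.
      exponential \<eta> (of_int b) * cnj (exponential \<eta> (of_int b')) * (M b l * cnj (M b' l)))"
    by (rule arg_cong[where f = "\<lambda>x. (r * r) * x"], rule sum.cong[OF refl], rule sum.swap)
  also have "\<dots> = (r * r) * (\<Sum>b\<in>B. \<Sum>b'\<in>B.
      exponential \<eta> (of_int b) * cnj (exponential \<eta> (of_int b')) * (if b = b' then 1 else 0))"
    unfolding sum_distrib_left[symmetric] using rows by (simp cong: sum.cong)
  also have "\<dots> = (r * r) * (\<Sum>b\<in>B. exponential \<eta> (of_int b) * cnj (exponential \<eta> (of_int b)))"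
    using finite_B by (simp add: if_distrib cong: if_cong)
  also have "\<dots> = 1"
    using n by (simp add: r2 n_def exponential_diff[symmetric])
  finally show ?thesis by (simp only: of_real_eq_1_iff)
qed

end

section \<open>The self-similar measure and its Fourier transform\<close>

definition ft :: "real measure \<Rightarrow> real \<Rightarrow> complex" where
  "ft \<mu> t = (LINT x|\<mu>. exponential t x)"

lemma ft_eq_char: "ft \<mu> t = char \<mu> (2 * pi * t)"
  by (simp add: ft_def char_def exponential_def mult_ac)

lemma measurable_exponential [measurable]: "exponential t \<in> borel_measurable borel"
  unfolding exponential_def[abs_def] by measurable

lemma measurable_ifs_map [measurable]: "ifs_map N b \<in> borel_measurable borel"
  unfolding ifs_map_def[abs_def] by measurable

lemma (in real_distribution) integrable_exponential [simp]: "integrable M (exponential t)"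
  by (rule integrable_const_bound[of _ 1]) simp_all

lemma norm_exponential_diff_le: "cmod (exponential s x - exponential t x) \<le> 2 * pi * \<bar>s - t\<bar> * \<bar>x\<bar>"
proof -
  have "exponential s x - exponential t x = exponential t x * (exponential (s - t) x - 1)"
    by (simp add: right_diff_distrib exponential_add[symmetric])
  then have "cmod (exponential s x - exponential t x) = cmod (exponential (s - t) x - 1)"
    by (simp add: norm_mult)
  also have "\<dots> = cmod (iexp (2 * pi * (s - t) * x) - 1)"
    by (simp add: exponential_def mult_ac)
  also have "\<dots> \<le> \<bar>2 * pi * (s - t) * x\<bar>"
    using iexp_approx1[of "2 * pi * (s - t) * x" 0] by (simp del: of_real_mult)
  finally show ?thesis by (simp add: abs_mult)
qed

locale affine_ifs =
  fixes N :: int and B :: "int set"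
  assumes N_ge2: "N \<ge> 2" and finite_B: "finite B" and B_nonempty: "B \<noteq> {}"
begin

lemma card_B_pos: "card B > 0"
  using finite_B B_nonempty by (simp add: card_gt_0_iff)

lemma self_similar_real_distribution:
  assumes "is_self_similar_measure N B \<mu>"
  shows "real_distribution \<mu>"
proof -
  interpret prob_space \<mu> using assms by (simp add: is_self_similar_measure_def)
  show ?thesis
    using assms by unfold_locales
      (auto simp: is_self_similar_measure_def dest: sets_eq_imp_space_eq)
qed

text \<open>The mixture of the image measures in the definition of self-similarity, written as an integral over
a random digit; this form gives access to the integral of a mixture.\<close>

lemma self_similar_eq_bind:
  assumes "is_self_similar_measure N B \<mu>"
  shows "\<mu> = measure_pmf (pmf_of_set B) \<bind> (\<lambda>b. distr \<mu> borel (ifs_map N b))"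
proof -
  interpret real_distribution \<mu> by (rule self_similar_real_distribution[OF assms])
  let ?p = "measure_pmf (pmf_of_set B)"
  have k: "(\<lambda>b. distr \<mu> borel (ifs_map N b)) \<in> measurable ?p (subprob_algebra borel)"
  proof -
    have "prob_space (distr \<mu> borel (ifs_map N b))" for b
      by (rule prob_space_distr) simp
    then show ?thesis
      by (auto simp: space_subprob_algebra prob_space_imp_subprob_space)
  qed
  interpret b: prob_space "?p \<bind> (\<lambda>b. distr \<mu> borel (ifs_map N b))"
    by (rule prob_space.prob_space_bind[OF measure_pmf.prob_space_axioms _ k])
       (intro AE_I2 prob_space_distr, simp)
  show ?thesis
  proof (rule measure_eqI)
    show "sets \<mu> = sets (?p \<bind> (\<lambda>b. distr \<mu> borel (ifs_map N b)))"
      by (subst sets_bind[OF sets_kernel[OF k]]) auto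
    fix A assume A: "A \<in> sets \<mu>"
    have "b.prob A = (LINT b|?p. measure (distr \<mu> borel (ifs_map N b)) A)"
      using A by (intro measure_pmf.measure_bind[OF k]) simp
    also have "\<dots> = 1 / real (card B) * (\<Sum>b\<in>B. measure (distr \<mu> borel (ifs_map N b)) A)"
      using finite_B B_nonempty by (simp add: integral_pmf_of_set)
    also have "\<dots> = prob A"
      using assms A by (simp add: is_self_similar_measure_def)
    finally show "emeasure \<mu> A = emeasure (?p \<bind> (\<lambda>b. distr \<mu> borel (ifs_map N b))) A"
      by (simp add: emeasure_eq_measure b.emeasure_eq_measure)
  qed
qed

lemma integral_self_similar:
  fixes f :: "real \<Rightarrow> real"
  assumes \<mu>: "is_self_similar_measure N B \<mu>"
    and f [measurable]: "f \<in> borel_measurable borel" and bound: "\<And>x. \<bar>f x\<bar> \<le> C"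
  shows "(LINT x|\<mu>. f x) = (\<Sum>b\<in>B. LINT x|\<mu>. f (ifs_map N b x)) / real (card B)"
proof -
  interpret real_distribution \<mu> by (rule self_similar_real_distribution[OF \<mu>])
  let ?p = "measure_pmf (pmf_of_set B)"
  have pr: "prob_space (distr \<mu> borel (ifs_map N b))" for b
    by (rule prob_space_distr) simp
  have k: "(\<lambda>b. distr \<mu> borel (ifs_map N b)) \<in> measurable ?p (subprob_algebra borel)"
    using pr by (auto simp: space_subprob_algebra prob_space_imp_subprob_space)
  have "(LINT x|\<mu>. f x) = (LINT x|(?p \<bind> (\<lambda>b. distr \<mu> borel (ifs_map N b))). f x)"
    using self_similar_eq_bind[OF \<mu>] by simp
  also have "\<dots> = (LINT b|?p. LINT x|distr \<mu> borel (ifs_map N b). f x)"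
    by (rule integral_bind[where K = borel and B = C and B' = 1])
       (use k bound in \<open>auto simp: prob_space.emeasure_space_1[OF pr, simplified] intro: measure_pmf.finite_measure\<close>)
  also have "\<dots> = (LINT b|?p. LINT x|\<mu>. f (ifs_map N b x))"
    by (simp add: integral_distr)
  also have "\<dots> = (\<Sum>b\<in>B. LINT x|\<mu>. f (ifs_map N b x)) / real (card B)"
    using finite_B B_nonempty by (simp add: integral_pmf_of_set)
  finally show ?thesis .
qed

lemma ft_self_similar:
  assumes "is_self_similar_measure N B \<mu>"
  shows "ft \<mu> t = mask_poly B (t / of_int N) * ft \<mu> (t / of_int N)"
proof -
  interpret real_distribution \<mu> by (rule self_similar_real_distribution[OF assms])
  have [measurable]: "exponential t \<in> borel_measurable borel" by simp
  have int: "integrable \<mu> (\<lambda>x. exponential t (ifs_map N b x))" for b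
    by (rule integrable_const_bound[of _ 1]) simp_all
  have shift: "exponential t (ifs_map N b x) = exponential (t / of_int N) (of_int b) * exponential (t / of_int N) x" for b x
    unfolding ifs_map_def by (simp add: exponential_def add_divide_distrib distrib_left exp_add mult_ac)
  have "ft \<mu> t = (\<Sum>b\<in>B. LINT x|\<mu>. exponential t (ifs_map N b x)) / of_nat (card B)"
  proof (rule complex_eqI)
    have "Re (ft \<mu> t) = (LINT x|\<mu>. Re (exponential t x))"
      unfolding ft_def by (rule integral_Re[symmetric]) simp
    also have "\<dots> = (\<Sum>b\<in>B. LINT x|\<mu>. Re (exponential t (ifs_map N b x))) / real (card B)"
      by (rule integral_self_similar[OF assms, of _ 1]) (auto intro: order.trans[OF abs_Re_le_cmod])
    also have "\<dots> = Re ((\<Sum>b\<in>B. LINT x|\<mu>. exponential t (ifs_map N b x)) / of_nat (card B))"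
      using int by simp
    finally show "Re (ft \<mu> t) = \<dots>" .
    have "Im (ft \<mu> t) = (LINT x|\<mu>. Im (exponential t x))"
      unfolding ft_def by (rule integral_Im[symmetric]) simp
    also have "\<dots> = (\<Sum>b\<in>B. LINT x|\<mu>. Im (exponential t (ifs_map N b x))) / real (card B)"
      by (rule integral_self_similar[OF assms, of _ 1]) (auto intro: order.trans[OF abs_Im_le_cmod])
    also have "\<dots> = Im ((\<Sum>b\<in>B. LINT x|\<mu>. exponential t (ifs_map N b x)) / of_nat (card B))"
      using int by simp
    finally show "Im (ft \<mu> t) = \<dots>" .
  qed
  also have "\<dots> = mask_poly B (t / of_int N) * ft \<mu> (t / of_int N)"
    by (simp add: shift mask_poly_def ft_def sum_distrib_right)
  finally show ?thesis .
qed

lemma ft_eq_prod_mask_poly: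
  assumes "is_self_similar_measure N B \<mu>"
  shows "ft \<mu> t = (\<Prod>i<n. mask_poly B (t / of_int N ^ Suc i)) * ft \<mu> (t / of_int N ^ n)"
proof (induction n)
  case (Suc n)
  show ?case
    by (subst Suc, subst ft_self_similar[OF assms]) (simp add: mult_ac)
qed simp

lemma tendsto_scale_0: "(\<lambda>n. t / of_int N ^ n :: real) \<longlonglongrightarrow> 0"
proof -
  have "(\<lambda>n. t * (1 / of_int N) ^ n :: real) \<longlonglongrightarrow> t * 0"
    using N_ge2 by (intro tendsto_intros LIMSEQ_realpow_zero) auto
  then show ?thesis by (simp add: power_one_over divide_inverse power_inverse)
qed

lemma ft_tendsto_prod_mask_poly:
  assumes "is_self_similar_measure N B \<mu>"
  shows "(\<lambda>n. \<Prod>i<n. mask_poly B (t / of_int N ^ Suc i)) \<longlonglongrightarrow> ft \<mu> t"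
proof -
  interpret real_distribution \<mu> by (rule self_similar_real_distribution[OF assms])
  have "(\<lambda>n. char \<mu> (2 * pi * (t / of_int N ^ n))) \<longlonglongrightarrow> char \<mu> (2 * pi * 0)"
    by (intro isCont_tendsto_compose[OF isCont_char] tendsto_intros tendsto_scale_0)
  then have 1: "(\<lambda>n. ft \<mu> (t / of_int N ^ n)) \<longlonglongrightarrow> 1"
    by (simp add: ft_eq_char char_zero)
  have "(\<lambda>n. ft \<mu> t / ft \<mu> (t / of_int N ^ n)) \<longlonglongrightarrow> ft \<mu> t / 1"
    by (intro tendsto_intros 1) simp
  moreover have "\<forall>\<^sub>F n in sequentially. ft \<mu> (t / of_int N ^ n) \<noteq> 0"
    using 1 by (rule tendsto_imp_eventually_ne) simp
  then have "\<forall>\<^sub>F n in sequentially. ft \<mu> t / ft \<mu> (t / of_int N ^ n) = (\<Prod>i<n. mask_poly B (t / of_int N ^ Suc i))"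
    by eventually_elim (metis ft_eq_prod_mask_poly[OF assms] nonzero_mult_div_cancel_right)
  ultimately show ?thesis by (simp add: tendsto_cong)
qed

text \<open>Iterating the functional equation expresses the Fourier transform as an infinite product of masks, and
the Fourier transform determines the measure.\<close>

lemma self_similar_unique:
  assumes "is_self_similar_measure N B \<mu>" "is_self_similar_measure N B \<nu>"
  shows "\<mu> = \<nu>"
proof (rule Levy_uniqueness)
  show "char \<mu> = char \<nu>"
  proof
    fix s
    have "ft \<mu> (s / (2 * pi)) = ft \<nu> (s / (2 * pi))"
      using ft_tendsto_prod_mask_poly[OF assms(1)] ft_tendsto_prod_mask_poly[OF assms(2)]
      by (rule LIMSEQ_unique)
    then show "char \<mu> s = char \<nu> s" by (simp add: ft_eq_char)
  qed
qed (use assms self_similar_real_distribution in auto)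

text \<open>Existence: the distribution of the random \<open>N\<close>-adic expansion \<open>\<Sum>i. b\<^sub>i / N ^ (i + 1)\<close> with
independent uniformly distributed digits \<open>b\<^sub>i \<in> B\<close> is self-similar, because splitting off the first
digit \<open>b\<close> applies the map \<open>x \<mapsto> (x + b) / N\<close>. Digits outside \<open>B\<close>, which almost surely do not occur, are read as
\<open>0\<close>; then the expansion of every digit stream converges and is bounded by the same constant.\<close>

definition digit :: "int \<Rightarrow> real" where
  "digit b = (if b \<in> B then of_int b else 0)"

definition expansion :: "int stream \<Rightarrow> real" where
  "expansion s = (\<Sum>i. digit (s !! i) / of_int N ^ Suc i)"

definition digit_bound :: real where
  "digit_bound = (\<Sum>b\<in>B. \<bar>of_int b\<bar>)"

lemma digit_le: "\<bar>digit b\<bar> \<le> digit_bound"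
  using finite_B unfolding digit_def digit_bound_def
  by (auto intro: member_le_sum sum_nonneg)

lemma geometric_sums: "(\<lambda>i. digit_bound / of_int N ^ Suc i) sums (digit_bound / (of_int N - 1))"
proof -
  have "(\<lambda>i. (digit_bound / of_int N) * (1 / of_int N) ^ i) sums ((digit_bound / of_int N) * (1 / (1 - 1 / of_int N)))"
    using N_ge2 by (intro sums_mult geometric_sums) auto
  moreover have "(digit_bound / of_int N) * (1 / (1 - 1 / of_int N)) = digit_bound / (of_int N - 1)"
    using N_ge2 by (simp add: field_simps)
  moreover have "(\<lambda>i. (digit_bound / of_int N) * (1 / of_int N) ^ i) = (\<lambda>i. digit_bound / of_int N ^ Suc i)"
    by (simp add: divide_inverse power_inverse mult_ac)
  ultimately show ?thesis by (simp only:)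
qed

lemma summable_norm_digits: "summable (\<lambda>i. norm (digit (s !! i) / of_int N ^ Suc i))"
proof (rule summable_comparison_test'[OF sums_summable[OF geometric_sums]])
  show "norm (norm (digit (s !! n) / of_int N ^ Suc n)) \<le> digit_bound / of_int N ^ Suc n" for n
    using N_ge2 digit_le by (simp add: divide_right_mono)
qed

lemma abs_expansion_le: "\<bar>expansion s\<bar> \<le> digit_bound / (of_int N - 1)"
proof -
  have "norm (expansion s) \<le> (\<Sum>i. norm (digit (s !! i) / of_int N ^ Suc i))"
    unfolding expansion_def by (rule summable_norm[OF summable_norm_digits])
  also have "\<dots> \<le> (\<Sum>i. digit_bound / of_int N ^ Suc i)"
    using N_ge2 digit_le
    by (intro suminf_le summable_norm_digits sums_summable[OF geometric_sums])
       (auto simp: divide_right_mono)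
  also have "\<dots> = digit_bound / (of_int N - 1)"
    by (rule sums_unique[OF geometric_sums, symmetric])
  finally show ?thesis by simp
qed

lemma expansion_Cons:
  assumes "b \<in> B"
  shows "expansion (b ## s) = ifs_map N b (expansion s)"
proof -
  have "expansion (b ## s) = digit b / of_int N + (\<Sum>i. digit (s !! i) / of_int N ^ Suc (Suc i))"
    unfolding expansion_def
    using suminf_split_head[OF summable_norm_cancel[OF summable_norm_digits[of "b ## s"]]] by simp
  also have "(\<Sum>i. digit (s !! i) / of_int N ^ Suc (Suc i)) = expansion s / of_int N"
    unfolding expansion_def
    by (subst suminf_divide[OF summable_norm_cancel[OF summable_norm_digits], symmetric])
       (simp add: mult_ac)
  finally show ?thesis using assms by (simp add: digit_def ifs_map_def add_divide_distrib add.commute)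
qed

definition expansion_measure :: "real measure" where
  "expansion_measure = distr (stream_space (measure_pmf (pmf_of_set B))) borel expansion"

lemma measurable_expansion [measurable]:
  "expansion \<in> borel_measurable (stream_space (measure_pmf (pmf_of_set B)))"
  unfolding expansion_def[abs_def] by measurable

lemma self_similar_expansion_measure: "is_self_similar_measure N B expansion_measure"
proof -
  let ?p = "measure_pmf (pmf_of_set B)"
  interpret S: prob_space "stream_space ?p"
    by (rule prob_space.prob_space_stream_space[OF measure_pmf.prob_space_axioms])
  have sp: "space (stream_space ?p) = UNIV" by (simp add: space_stream_space)
  have "prob_space expansion_measure"
    unfolding expansion_measure_def by (rule S.prob_space_distr) measurable
  moreover have "measure expansion_measure A =
      1 / real (card B) * (\<Sum>b\<in>B. measure (distr expansion_measure borel (ifs_map N b)) A)"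
    if [measurable]: "A \<in> sets borel" for A
  proof -
    have "measure expansion_measure A = S.prob {s \<in> space (stream_space ?p). expansion s \<in> A}"
      unfolding expansion_measure_def by (subst measure_distr) (auto simp: sp vimage_def)
    also have "\<dots> = (\<Sum>b\<in>B. S.prob {s. expansion (b ## s) \<in> A}) / card B"
    proof -
      have "ennreal (S.prob {s \<in> space (stream_space ?p). expansion s \<in> A})
          = (\<integral>\<^sup>+b. S.prob {s \<in> space (stream_space ?p). expansion (b ## s) \<in> A} \<partial>?p)"
        by (rule prob_space.prob_stream_space[OF measure_pmf.prob_space_axioms]) measurable
      also have "\<dots> = ennreal ((\<Sum>b\<in>B. S.prob {s. expansion (b ## s) \<in> A}) / card B)"
        using card_B_pos finite_B B_nonempty
        by (simp add: nn_integral_pmf_of_set sp divide_ennreal sum_nonneg ennreal_of_nat_eq_real_of_nat)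
      finally show ?thesis by (simp add: sum_nonneg)
    qed
    also have "\<dots> = (\<Sum>b\<in>B. measure (distr expansion_measure borel (ifs_map N b)) A) / card B"
    proof -
      have "measure (distr expansion_measure borel (ifs_map N b)) A = S.prob {s. expansion (b ## s) \<in> A}"
        if "b \<in> B" for b
      proof -
        have "distr expansion_measure borel (ifs_map N b) = distr (stream_space ?p) borel (ifs_map N b \<circ> expansion)"
          unfolding expansion_measure_def by (rule distr_distr) measurable
        then show ?thesis
          by (simp add: measure_distr sp vimage_def expansion_Cons[OF that])
      qed
      then show ?thesis by simp
    qed
    finally show ?thesis by simp
  qed
  ultimately show ?thesis
    by (simp add: is_self_similar_measure_def) (simp add: expansion_measure_def)
qed

abbreviation "\<mu> \<equiv> self_similar_measure N B"

lemma self_similar_measure_eq_expansion: "\<mu> = expansion_measure"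
  unfolding self_similar_measure_def
proof (rule the_equality)
  show "is_self_similar_measure N B expansion_measure" by (rule self_similar_expansion_measure)
  show "\<nu> = expansion_measure" if "is_self_similar_measure N B \<nu>" for \<nu>
    using that self_similar_expansion_measure by (rule self_similar_unique)
qed

lemma is_self_similar: "is_self_similar_measure N B \<mu>"
  unfolding self_similar_measure_eq_expansion by (rule self_similar_expansion_measure)

sublocale \<mu>: real_distribution \<mu>
  by (rule self_similar_real_distribution[OF is_self_similar])

definition radius :: real where
  "radius = digit_bound / (of_int N - 1)"

lemma radius_nonneg: "radius \<ge> 0"
  unfolding radius_def digit_bound_def using N_ge2 by (intro divide_nonneg_nonneg sum_nonneg) auto

lemma AE_abs_le_radius: "AE x in \<mu>. \<bar>x\<bar> \<le> radius"
  unfolding self_similar_measure_eq_expansion expansion_measure_def radius_def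
  by (subst AE_distr_iff) (auto simp: abs_expansion_le)

lemma ft_0 [simp]: "ft \<mu> 0 = 1"
  by (simp add: ft_eq_char \<mu>.char_zero)

lemma ft_lipschitz: "cmod (ft \<mu> s - ft \<mu> t) \<le> 2 * pi * radius * \<bar>s - t\<bar>"
proof -
  have "ft \<mu> s - ft \<mu> t = (LINT x|\<mu>. exponential s x - exponential t x)"
    unfolding ft_def by (rule Bochner_Integration.integral_diff[symmetric]) simp_all
  also have "cmod \<dots> \<le> (LINT x|\<mu>. cmod (exponential s x - exponential t x))"
    by (rule integral_norm_bound)
  also have "\<dots> \<le> (LINT x|\<mu>. 2 * pi * radius * \<bar>s - t\<bar>)"
  proof (rule integral_mono_AE)
    show "AE x in \<mu>. cmod (exponential s x - exponential t x) \<le> 2 * pi * radius * \<bar>s - t\<bar>"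
      using AE_abs_le_radius
    proof eventually_elim
      case (elim x)
      have "2 * pi * \<bar>s - t\<bar> * \<bar>x\<bar> \<le> 2 * pi * \<bar>s - t\<bar> * radius"
        using elim by (intro mult_left_mono) auto
      from order.trans[OF norm_exponential_diff_le this] show ?case by (simp only: mult_ac)
    qed
  qed simp_all
  also have "\<dots> = 2 * pi * radius * \<bar>s - t\<bar>"
    by (simp add: \<mu>.prob_space del: \<mu>.space_eq_univ)
  finally show ?thesis .
qed

end

sublocale hadamard \<subseteq> affine_ifs N B
  by unfold_locales (rule N_ge2 finite_B B_nonempty)+

section \<open>Cosets of zeros of the Fourier transform\<close>

context affine_ifs
begin

text \<open>The mask extends to an entire function that is not identically zero.\<close>

lemma finite_zeros_mask_poly: "finite {x. \<bar>x\<bar> \<le> r \<and> mask_poly B x = 0}"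
proof -
  define f where "f z = (\<Sum>b\<in>B. exp (2 * complex_of_real pi * \<i> * z * of_int b))" for z
  have f: "f (of_real x) = of_nat (card B) * mask_poly B x" for x
    using card_B_pos by (simp add: f_def mask_poly_def exponential_def)
  have hol: "f holomorphic_on UNIV"
    unfolding f_def[abs_def] by (intro holomorphic_intros)
  have fin: "finite {z \<in> cball 0 r. f z = 0}"
  proof (cases "f constant_on UNIV")
    case True
    moreover have "f 0 \<noteq> 0" using card_B_pos by (simp add: f_def)
    ultimately have "f z \<noteq> 0" for z by (metis UNIV_I constant_on_def)
    then show ?thesis by simp
  next
    case False
    then show ?thesis by (intro holomorphic_compact_finite_zeros[OF hol]) auto
  qed
  have "of_real ` {x. \<bar>x\<bar> \<le> r \<and> mask_poly B x = 0} \<subseteq> {z \<in> cball 0 r. f z = 0}"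
    by (auto simp: f)
  then have "finite (complex_of_real ` {x. \<bar>x\<bar> \<le> r \<and> mask_poly B x = 0})"
    using fin by (rule finite_subset)
  then show ?thesis by (rule finite_imageD) (simp add: inj_on_def)
qed

lemma exists_scale_small:
  assumes "\<epsilon> > 0"
  shows "\<exists>n0. \<forall>n\<ge>n0. \<bar>t\<bar> / of_int N ^ n < (\<epsilon> :: real)"
proof -
  have "\<forall>\<^sub>F n in sequentially. \<bar>t\<bar> / of_int N ^ n < \<epsilon>"
    by (rule order_tendstoD(2)[OF tendsto_scale_0 assms])
  then show ?thesis by (simp add: eventually_sequentially)
qed

lemma ft_near_1:
  assumes "2 * pi * radius * \<bar>t\<bar> \<le> \<epsilon>"
  shows "cmod (ft \<mu> t) \<ge> 1 - \<epsilon>"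
proof -
  have "cmod (ft \<mu> t - 1) \<le> \<epsilon>"
    using ft_lipschitz[of t 0] assms by simp
  then show ?thesis
    using norm_triangle_ineq2[of 1 "1 - ft \<mu> t"] by (simp add: norm_minus_commute)
qed

text \<open>Near \<open>0\<close> the Fourier transform does not vanish, so on a bounded interval its zeros are zeros of one
of the first \<open>n\<close> factors of the infinite product, for a suitable \<open>n\<close>.\<close>

lemma finite_zeros_ft: "finite {x. \<bar>x\<bar> \<le> r \<and> ft \<mu> x = 0}"
proof -
  define K where "K = 2 * pi * radius"
  obtain n where n: "\<bar>K * r\<bar> / of_int N ^ n < 1"
    using exists_scale_small[of 1 "K * r"] by auto
  have N0: "(of_int N :: real) > 0" using N_ge2 by simp
  have K0: "K \<ge> 0" unfolding K_def using radius_nonneg by simp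
  have nz: "ft \<mu> (x / of_int N ^ n) \<noteq> 0" if "\<bar>x\<bar> \<le> r" for x
  proof -
    have "K * \<bar>x / of_int N ^ n\<bar> \<le> \<bar>K * r\<bar> / of_int N ^ n"
      using N0 K0 that by (simp add: abs_mult divide_right_mono mult_left_mono)
    then have "cmod (ft \<mu> (x / of_int N ^ n)) \<ge> 1 - \<bar>K * r\<bar> / of_int N ^ n"
      by (intro ft_near_1) (simp add: K_def)
    then show ?thesis using n by auto
  qed
  define Z where "Z i = (\<lambda>y. y * of_int N ^ Suc i) ` {y. \<bar>y\<bar> \<le> r \<and> mask_poly B y = 0}" for i :: nat
  have "{x. \<bar>x\<bar> \<le> r \<and> ft \<mu> x = 0} \<subseteq> (\<Union>i<n. Z i)"
  proof safe
    fix x assume x: "\<bar>x\<bar> \<le> r" "ft \<mu> x = 0"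
    then have "(\<Prod>i<n. mask_poly B (x / of_int N ^ Suc i)) = 0"
      using ft_eq_prod_mask_poly[OF is_self_similar, of x n] nz by simp
    then obtain i where i: "i < n" "mask_poly B (x / of_int N ^ Suc i) = 0" by auto
    have "(1::real) \<le> of_int N ^ Suc i" using N_ge2 by (intro one_le_power) simp
    then have "\<bar>x\<bar> / of_int N ^ Suc i \<le> \<bar>x\<bar>"
      using mult_left_mono[of 1 "of_int N ^ Suc i" "\<bar>x\<bar>"] N0 by (simp add: divide_le_eq del: power_Suc)
    then have "\<bar>x / of_int N ^ Suc i\<bar> \<le> r"
      using x(1) N0 by (simp del: power_Suc)
    then have "x \<in> Z i"
      unfolding Z_def using i N0 by (intro image_eqI[of _ _ "x / of_int N ^ Suc i"]) auto
    then show "x \<in> (\<Union>i<n. Z i)" using i(1) by blast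
  qed
  moreover have "finite (\<Union>i<n. Z i)"
    unfolding Z_def using finite_zeros_mask_poly by simp
  ultimately show ?thesis by (rule finite_subset)
qed

end

locale sparse_hadamard = hadamard +
  assumes sparse: "int (card B) < N"
begin

text \<open>The sum of squares over \<open>L\<close> in Parseval's identity is not zero.\<close>

lemma exists_mask_poly_nonzero:
  assumes u: "coprime (int u) N"
  shows "\<exists>l\<in>L. mask_poly B ((x + of_nat u * of_int (a + l)) / of_int N) \<noteq> 0"
proof (rule ccontr)
  assume "\<not> ?thesis"
  moreover have "(x + of_nat u * of_int (a + l)) / of_int N
      = (x + of_nat u * of_int a) / of_int N + of_nat u * of_int l / of_int N" for l
    by (simp add: add_divide_distrib distrib_left)
  ultimately show False
    using sum_norm_mask_poly_sq[OF u, of "(x + of_nat u * of_int a) / of_int N"] by simp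
qed

text \<open>If only one residue class \<open>a1\<close> modulo \<open>N\<close> gave a nonzero mask, every translate of \<open>L\<close> would have to
meet it, so the classes \<open>a1 - l\<close> with \<open>l \<in> L\<close> would exhaust all \<open>N\<close> classes. As \<open>L\<close> has fewer
than \<open>N\<close> elements, this is impossible.\<close>

lemma two_branches_mask_poly_nonzero:
  assumes u: "coprime (int u) N"
  shows "\<exists>a1 a2. \<not> N dvd a1 - a2 \<and> mask_poly B ((x + of_nat u * of_int a1) / of_int N) \<noteq> 0 \<and>
    mask_poly B ((x + of_nat u * of_int a2) / of_int N) \<noteq> 0"
proof -
  obtain a1 where a1: "mask_poly B ((x + of_nat u * of_int (0 + a1)) / of_int N) \<noteq> 0"
    using exists_mask_poly_nonzero[OF u] by blast
  have "card ((\<lambda>l. (a1 - l) mod N) ` L) \<le> card L"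
    by (rule card_image_le[OF finite_L])
  also have "\<dots> < card {0..<N}"
    using sparse card_eq N_ge2 by simp
  finally have "\<not> {0..<N} \<subseteq> (\<lambda>l. (a1 - l) mod N) ` L"
    using card_mono[OF finite_imageI[OF finite_L]] by (meson not_le)
  then obtain a where "a \<in> {0..<N}" and a_notin: "a \<notin> (\<lambda>l. (a1 - l) mod N) ` L" by blast
  then have a: "0 \<le> a" "a < N" by simp_all
  obtain l where l: "l \<in> L" "mask_poly B ((x + of_nat u * of_int (a + l)) / of_int N) \<noteq> 0"
    using exists_mask_poly_nonzero[OF u] by blast
  have "\<not> N dvd a1 - (a + l)"
  proof
    assume "N dvd a1 - (a + l)"
    then have "N dvd (a1 - l) - a" by (simp add: algebra_simps)
    then have "(a1 - l) mod N = a mod N" by (simp add: mod_eq_dvd_iff)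
    then have "a = (a1 - l) mod N" using a by simp
    then show False using a_notin l(1) by blast
  qed
  then show ?thesis using a1 l(2) by (intro exI[of _ a1] exI[of _ "a + l"]) simp
qed

text \<open>Let \<open>Z\<close> be the set of points \<open>x\<close> such that the Fourier transform vanishes on all of \<open>x + u \<int>\<close>; the claim
is that it is empty. It is invariant under translation by \<open>u\<close> and finite modulo \<open>u\<close>. By the functional
equation, \<open>(x + u a) / N\<close> is in \<open>Z\<close> whenever \<open>x\<close> is in \<open>Z\<close> and the mask does not vanish at that point. By the
previous lemma at least two of these branches survive for each \<open>x\<close>, and they are distinct modulo \<open>u\<close>.
So multiplication by \<open>N\<close> maps the finite set \<open>Z\<close> modulo \<open>u\<close> to itself in such a way that every
point has at least two preimages, and a nonempty finite set admits no such map. Sparsity is essential: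
for Lebesgue measure on the unit interval, where \<open>card B = N\<close>, the Fourier transform vanishes on
\<open>1 + 2 \<int>\<close>, although \<open>2\<close> is prime to every odd \<open>N\<close>.\<close>

theorem exists_ft_nonzero_on_coset:
  assumes u: "coprime (int u) N" and u0: "u > 0"
  shows "\<exists>k::int. ft \<mu> (x + of_nat u * of_int k) \<noteq> 0"
proof (rule ccontr)
  assume "\<not> ?thesis"
  then have x: "\<And>k::int. ft \<mu> (x + of_nat u * of_int k) = 0" by blast
  define Z where "Z = {x. \<forall>k::int. ft \<mu> (x + of_nat u * of_int k) = 0}"
  define red where "red x = of_nat u * frac (x / of_nat u)" for x :: real
  have N0: "(of_int N :: real) > 0" using N_ge2 by simp
  have red_eq: "red x = x - of_nat u * of_int \<lfloor>x / of_nat u\<rfloor>" for x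
    using u0 by (simp add: red_def frac_def right_diff_distrib)
  have red_shift: "red (x + of_nat u * of_int k) = red x" for x and k :: int
    using u0 by (simp add: red_def add_divide_distrib)
  have red_id: "red x = x" if "x \<in> {0..<of_nat u}" for x
    using that u0 by (simp add: red_def frac_eq)
  have red_range: "red x \<in> {0..<of_nat u}" for x
    using u0 frac_lt_1[of "x / of_nat u"] frac_ge_0[of "x / of_nat u"] by (simp add: red_def)
  have Z_shift: "x + of_nat u * of_int j \<in> Z" if "x \<in> Z" for x and j :: int
    using that unfolding Z_def
    by (auto simp: add.assoc distrib_left[symmetric] of_int_add[symmetric] simp del: of_int_add)
  have Z_red: "red x \<in> Z" if "x \<in> Z" for x
    using Z_shift[OF that, of "- \<lfloor>x / of_nat u\<rfloor>"] by (simp add: red_eq)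
  define Z0 where "Z0 = Z \<inter> {0..<of_nat u}"
  have "Z0 \<subseteq> {x. \<bar>x\<bar> \<le> real u \<and> ft \<mu> x = 0}"
    unfolding Z0_def Z_def by (auto dest: spec[of _ 0])
  then have finZ0: "finite Z0" using finite_zeros_ft by (rule finite_subset)
  have Z0_red: "red y \<in> Z0" if "y \<in> Z" for y
    using Z_red[OF that] red_range by (simp add: Z0_def)
  \<comment> \<open>surviving branches stay in \<open>Z\<close>: shift \<open>a\<close> by multiples of \<open>N\<close> and use that the mask has period 1\<close>
  have branch: "(x + of_nat u * of_int a) / of_int N \<in> Z"
    if x: "x \<in> Z" and a: "mask_poly B ((x + of_nat u * of_int a) / of_int N) \<noteq> 0" for x a
    unfolding Z_def
  proof safe
    fix k :: int
    let ?y = "(x + of_nat u * of_int a) / of_int N"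
    have "(x + of_nat u * of_int (a + N * k)) / of_int N = ?y + of_int (int u * k)"
      using N0 by (simp add: field_simps)
    then have "0 = mask_poly B (?y + of_int (int u * k)) * ft \<mu> (?y + of_int (int u * k))"
      using x ft_self_similar[OF is_self_similar, of "x + of_nat u * of_int (a + N * k)"]
      by (simp add: Z_def del: of_int_add of_int_mult)
    then show "ft \<mu> (?y + of_nat u * of_int k) = 0"
      using a unfolding mask_poly_add_int by simp
  qed
  have "\<exists>y1 y2. y1 \<in> Z0 \<and> y2 \<in> Z0 \<and> y1 \<noteq> y2 \<and> red (of_int N * y1) = x \<and> red (of_int N * y2) = x"
    if x: "x \<in> Z0" for x
  proof -
    obtain a1 a2 where a: "\<not> N dvd a1 - a2"
      "mask_poly B ((x + of_nat u * of_int a1) / of_int N) \<noteq> 0"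
      "mask_poly B ((x + of_nat u * of_int a2) / of_int N) \<noteq> 0"
      using two_branches_mask_poly_nonzero[OF u] by blast
    define y where "y a = (x + of_nat u * of_int a) / of_int N" for a :: int
    have retract: "red (of_int N * red (y a)) = x" for a
    proof -
      have "of_int N * red (y a) = x + of_nat u * of_int (a - N * \<lfloor>y a / of_nat u\<rfloor>)"
        unfolding red_eq y_def using N0 by (simp add: field_simps)
      then show ?thesis using red_shift red_id x by (simp only: Z0_def) auto
    qed
    have "red (y a1) \<noteq> red (y a2)"
    proof
      assume "red (y a1) = red (y a2)"
      then have "y a1 - y a2 = of_nat u * of_int (\<lfloor>y a1 / of_nat u\<rfloor> - \<lfloor>y a2 / of_nat u\<rfloor>)"
        by (simp add: red_eq algebra_simps)
      moreover have "y a1 - y a2 = of_nat u * of_int (a1 - a2) / of_int N"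
        using N0 by (simp add: y_def field_simps)
      ultimately have "of_nat u * (of_int (a1 - a2) :: real) = of_nat u * of_int (N * (\<lfloor>y a1 / of_nat u\<rfloor> - \<lfloor>y a2 / of_nat u\<rfloor>))"
        using N0 by (simp add: divide_eq_eq mult_ac)
      then have "(of_int (a1 - a2) :: real) = of_int (N * (\<lfloor>y a1 / of_nat u\<rfloor> - \<lfloor>y a2 / of_nat u\<rfloor>))"
        using u0 by (subst (asm) mult_left_cancel) simp_all
      then have "a1 - a2 = N * (\<lfloor>y a1 / of_nat u\<rfloor> - \<lfloor>y a2 / of_nat u\<rfloor>)"
        by (simp only: of_int_eq_iff)
      then show False using a(1) by simp
    qed
    moreover have "red (y a1) \<in> Z0" "red (y a2) \<in> Z0"
      using x a unfolding y_def by (blast intro: Z0_red branch[OF IntD1[OF x[unfolded Z0_def]]])+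
    ultimately show ?thesis using retract by blast
  qed
  then obtain f1 f2 where f: "\<And>x. x \<in> Z0 \<Longrightarrow> f1 x \<in> Z0 \<and> f2 x \<in> Z0 \<and> f1 x \<noteq> f2 x \<and>
      red (of_int N * f1 x) = x \<and> red (of_int N * f2 x) = x"
    by metis
  have "inj_on f1 Z0" by (rule inj_on_inverseI[of _ "\<lambda>y. red (of_int N * y)"]) (use f in blast)
  then have "f1 ` Z0 = Z0" using f by (intro endo_inj_surj[OF finZ0]) auto
  have "x \<in> Z" unfolding Z_def using x by blast
  then have z: "red x \<in> Z0" by (rule Z0_red)
  then have "f2 (red x) \<in> f1 ` Z0" using f \<open>f1 ` Z0 = Z0\<close> by blast
  then obtain x' where "x' \<in> Z0" "f2 (red x) = f1 x'" by blast
  then show False using f z by metis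
qed

text \<open>Compactness of the unit interval, which suffices because \<open>k\<close> ranges over all integers.\<close>

lemma exists_uniform_lower_bound:
  assumes u: "coprime (int u) N" and u0: "u > 0"
  shows "\<exists>c>0. \<forall>y. \<exists>k::int. cmod (ft \<mu> (of_nat u * (y + of_int k))) \<ge> c"
proof (rule ccontr)
  assume "\<not> ?thesis"
  then have neg: "\<And>c. c > 0 \<Longrightarrow> \<exists>y. \<forall>k::int. cmod (ft \<mu> (of_nat u * (y + of_int k))) < c"
    by (meson not_le)
  have "\<exists>y\<in>{0..1}. \<forall>k::int. cmod (ft \<mu> (of_nat u * (y + of_int k))) < 1 / real (Suc n)" for n
  proof -
    obtain y where y: "\<And>k::int. cmod (ft \<mu> (of_nat u * (y + of_int k))) < 1 / real (Suc n)"
      using neg[of "1 / real (Suc n)"] by auto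
    have "frac y + of_int k = y + of_int (k - \<lfloor>y\<rfloor>)" for k
      by (simp add: frac_def)
    then have "cmod (ft \<mu> (of_nat u * (frac y + of_int k))) < 1 / real (Suc n)" for k
      using y by (simp only:)
    then show ?thesis
      using frac_ge_0[of y] frac_lt_1[of y] by (intro bexI[of _ "frac y"]) auto
  qed
  then obtain y where y: "\<And>n. y n \<in> {0..1}"
    "\<And>n k. cmod (ft \<mu> (of_nat u * (y n + of_int k))) < 1 / real (Suc n)"
    by metis
  obtain z r where r: "strict_mono (r :: nat \<Rightarrow> nat)" "(y \<circ> r) \<longlonglongrightarrow> z"
    using compact_imp_seq_compact[OF compact_Icc[of 0 "1::real"]] y(1) unfolding seq_compact_def by metis
  have "ft \<mu> (of_nat u * (z + of_int k)) = 0" for k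
  proof -
    have cont: "isCont (ft \<mu>) t" for t
    proof -
      have "isCont (\<lambda>t. char \<mu> (2 * pi * t)) t"
        by (intro isCont_o2[OF _ \<mu>.isCont_char] continuous_intros)
      then show ?thesis by (simp add: ft_eq_char[abs_def])
    qed
    have "(\<lambda>n. ft \<mu> (of_nat u * ((y \<circ> r) n + of_int k))) \<longlonglongrightarrow> ft \<mu> (of_nat u * (z + of_int k))"
      by (intro isCont_tendsto_compose[OF cont] tendsto_intros r(2))
    moreover have "(\<lambda>n. ft \<mu> (of_nat u * ((y \<circ> r) n + of_int k))) \<longlonglongrightarrow> 0"
    proof (rule Lim_null_comparison)
      have "(\<lambda>n. 1 / real (Suc n)) \<longlonglongrightarrow> 0" by (rule LIMSEQ_Suc[OF lim_1_over_n])
      then show "(\<lambda>n. 1 / real (Suc (r n))) \<longlonglongrightarrow> 0"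
        using LIMSEQ_subseq_LIMSEQ[OF _ r(1)] by (auto simp: o_def)
      show "\<forall>\<^sub>F n in sequentially. cmod (ft \<mu> (of_nat u * ((y \<circ> r) n + of_int k))) \<le> 1 / real (Suc (r n))"
        using y(2)[of "r n" k for n] by (auto intro!: always_eventually less_imp_le)
    qed
    ultimately show ?thesis by (rule LIMSEQ_unique)
  qed
  moreover obtain k where "ft \<mu> (of_nat u * z + of_nat u * of_int k) \<noteq> 0"
    using exists_ft_nonzero_on_coset[OF u u0] by blast
  ultimately show False by (simp add: distrib_left)
qed

end

section \<open>Simultaneous spectra of the truncated expansions and their limit\<close>

context affine_ifs
begin

text \<open>The first \<open>n\<close> factors of the infinite product: the Fourier transform of the distribution of the
\<open>N\<close>-adic expansion truncated after \<open>n\<close> digits.\<close>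

definition ft_level :: "nat \<Rightarrow> real \<Rightarrow> complex" where
  "ft_level n t = (\<Prod>i<n. mask_poly B (t / of_int N ^ Suc i))"

lemma ft_eq_ft_level: "ft \<mu> t = ft_level n t * ft \<mu> (t / of_int N ^ n)"
  unfolding ft_level_def by (rule ft_eq_prod_mask_poly[OF is_self_similar])

lemma ft_level_tendsto: "(\<lambda>n. ft_level n t) \<longlonglongrightarrow> ft \<mu> t"
  unfolding ft_level_def by (rule ft_tendsto_prod_mask_poly[OF is_self_similar])

lemma ft_level_Suc: "ft_level (Suc n) t = ft_level n t * mask_poly B (t / of_int N ^ Suc n)"
  by (simp add: ft_level_def)

lemma ft_level_0_left [simp]: "ft_level 0 t = 1"
  by (simp add: ft_level_def)

lemma ft_level_at_0 [simp]: "ft_level n 0 = 1"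
  using mask_poly_0[OF finite_B B_nonempty] by (simp add: ft_level_def)

lemma ft_level_periodic: "ft_level n (t + of_int (N ^ n * k)) = ft_level n t"
  unfolding ft_level_def
proof (rule prod.cong[OF refl])
  fix i assume "i \<in> {..<n}"
  then have "n = Suc i + (n - Suc i)" by simp
  then have "N ^ n = N ^ Suc i * N ^ (n - Suc i)" by (metis power_add)
  then have "(t + of_int (N ^ n * k)) / of_int N ^ Suc i = t / of_int N ^ Suc i + of_int (N ^ (n - Suc i) * k)"
    using N_ge2 by (simp add: add_divide_distrib)
  then show "mask_poly B ((t + of_int (N ^ n * k)) / of_int N ^ Suc i) = mask_poly B (t / of_int N ^ Suc i)"
    by (simp only: mask_poly_add_int)
qed

lemma norm_ft_le_1: "cmod (ft \<mu> t) \<le> 1"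
  by (simp add: ft_eq_char \<mu>.cmod_char_le_1)

lemma norm_ft_le_ft_level: "cmod (ft \<mu> t) \<le> cmod (ft_level n t)"
  using mult_left_mono[OF norm_ft_le_1[of "t / of_int N ^ n"], of "cmod (ft_level n t)"]
  by (subst ft_eq_ft_level[of t n]) (simp add: norm_mult)

text \<open>By Parseval's identity, \<open>level_spectrum n \<Gamma>\<close> means that \<open>u \<Gamma>\<close> is a spectrum of the distribution
of the truncated expansion, simultaneously for all multipliers \<open>u\<close> prime to \<open>N\<close>. This
formulation with sums of squares contains the orthogonality of \<open>u \<Gamma>\<close> and is what the passage to the limit needs.\<close>

definition level_spectrum :: "nat \<Rightarrow> int set \<Rightarrow> bool" where
  "level_spectrum n \<Gamma> \<longleftrightarrow> finite \<Gamma> \<and>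
     (\<forall>u \<xi>. coprime (int u) N \<longrightarrow> (\<Sum>\<gamma>\<in>\<Gamma>. (cmod (ft_level n (\<xi> + of_nat u * of_int \<gamma>)))\<^sup>2) = 1)"

lemma level_spectrum_finite: "level_spectrum n \<Gamma> \<Longrightarrow> finite \<Gamma>"
  by (simp add: level_spectrum_def)

lemma level_spectrum_sum:
  "level_spectrum n \<Gamma> \<Longrightarrow> coprime (int u) N \<Longrightarrow>
    (\<Sum>\<gamma>\<in>\<Gamma>. (cmod (ft_level n (\<xi> + of_nat u * of_int \<gamma>)))\<^sup>2) = 1"
  by (simp add: level_spectrum_def)

text \<open>At \<open>\<xi> = - u \<gamma>'\<close> the term of \<open>\<gamma>'\<close> alone is already \<open>1\<close>.\<close>

lemma level_spectrum_orthogonal: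
  assumes \<Gamma>: "level_spectrum n \<Gamma>" and u: "coprime (int u) N"
    and "\<gamma> \<in> \<Gamma>" "\<gamma>' \<in> \<Gamma>" "\<gamma> \<noteq> \<gamma>'"
  shows "ft_level n (of_nat u * (of_int \<gamma> - of_int \<gamma>')) = 0"
proof -
  let ?g = "\<lambda>\<delta>. (cmod (ft_level n (- (of_nat u * of_int \<gamma>') + of_nat u * of_int \<delta>)))\<^sup>2"
  have fin: "finite \<Gamma>" using \<Gamma> by (rule level_spectrum_finite)
  have "1 = ?g \<gamma>' + sum ?g (\<Gamma> - {\<gamma>'})"
    using level_spectrum_sum[OF \<Gamma> u, of "- (of_nat u * of_int \<gamma>')"] sum.remove[OF fin assms(4), of ?g] by simp
  then have "sum ?g (\<Gamma> - {\<gamma>'}) = 0" by simp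
  then have "?g \<gamma> = 0"
    using fin assms(3,5) by (subst (asm) sum_nonneg_eq_0_iff) auto
  then show ?thesis by (simp add: right_diff_distrib)
qed

lemma level_spectrum_not_congruent:
  assumes "level_spectrum n \<Gamma>" "\<gamma> \<in> \<Gamma>" "\<gamma>' \<in> \<Gamma>" "N ^ n dvd \<gamma> - \<gamma>'"
  shows "\<gamma> = \<gamma>'"
proof (rule ccontr)
  assume "\<gamma> \<noteq> \<gamma>'"
  then have "ft_level n (of_int (\<gamma> - \<gamma>')) = 0"
    using level_spectrum_orthogonal[OF assms(1), of 1 \<gamma> \<gamma>'] assms(2,3) by simp
  moreover obtain k where "\<gamma> - \<gamma>' = N ^ n * k" using assms(4) by blast
  ultimately show False using ft_level_periodic[of n 0 k] by simp
qed

lemma level_spectrum_singleton_0: "level_spectrum 0 {0}"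
  by (simp add: level_spectrum_def)

text \<open>Only the classes of the elements modulo \<open>N ^ n\<close> matter, so that each element can be moved within its class.\<close>

lemma level_spectrum_translate_classes:
  assumes \<Gamma>: "level_spectrum n \<Gamma>"
  shows "level_spectrum n ((\<lambda>\<gamma>. \<gamma> + N ^ n * k \<gamma>) ` \<Gamma>)"
proof -
  have inj: "inj_on (\<lambda>\<gamma>. \<gamma> + N ^ n * k \<gamma>) \<Gamma>"
  proof (rule inj_onI)
    fix \<gamma> \<gamma>' assume *: "\<gamma> \<in> \<Gamma>" "\<gamma>' \<in> \<Gamma>" "\<gamma> + N ^ n * k \<gamma> = \<gamma>' + N ^ n * k \<gamma>'"
    then have "\<gamma> - \<gamma>' = N ^ n * (k \<gamma>' - k \<gamma>)" by (simp add: right_diff_distrib)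
    then show "\<gamma> = \<gamma>'" using level_spectrum_not_congruent[OF \<Gamma>] * by simp
  qed
  have "ft_level n (\<xi> + of_nat u * of_int (\<gamma> + N ^ n * k \<gamma>)) = ft_level n (\<xi> + of_nat u * of_int \<gamma>)" for \<xi> u \<gamma>
    using ft_level_periodic[of n "\<xi> + of_nat u * of_int \<gamma>" "int u * k \<gamma>"] by (simp add: algebra_simps)
  then show ?thesis
    using \<Gamma> by (simp add: level_spectrum_def sum.reindex[OF inj])
qed

end

context hadamard
begin

text \<open>The new factor of the product is summed over \<open>L\<close> by Parseval's identity. The translation by \<open>l0\<close> is
there to make the extended set contain the old one, by the choice \<open>l = l0\<close>.\<close>

lemma level_spectrum_Suc:
  assumes \<Gamma>: "level_spectrum n \<Gamma>"
  shows "level_spectrum (Suc n) ((\<lambda>(\<gamma>, l). \<gamma> + N ^ n * (l - l0)) ` (\<Gamma> \<times> L))"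
proof -
  define f where "f = (\<lambda>(\<gamma>, l). \<gamma> + N ^ n * (l - l0))"
  have inj: "inj_on f (\<Gamma> \<times> L)"
  proof (rule inj_onI, clarify)
    fix \<gamma> l \<gamma>' l' assume *: "\<gamma> \<in> \<Gamma>" "\<gamma>' \<in> \<Gamma>" "f (\<gamma>, l) = f (\<gamma>', l')"
    then have "\<gamma> - \<gamma>' = N ^ n * (l' - l)" by (simp add: f_def algebra_simps)
    then have "\<gamma> = \<gamma>'" using level_spectrum_not_congruent[OF \<Gamma>] * by simp
    then show "\<gamma> = \<gamma>' \<and> l = l'" using *(3) N_ge2 by (auto simp: f_def)
  qed
  have "(\<Sum>\<gamma>\<in>f ` (\<Gamma> \<times> L). (cmod (ft_level (Suc n) (\<xi> + of_nat u * of_int \<gamma>)))\<^sup>2) = 1"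
    if u: "coprime (int u) N" for u \<xi>
  proof -
    have split: "ft_level (Suc n) (\<xi> + of_nat u * of_int (f (\<gamma>, l))) =
        ft_level n (\<xi> + of_nat u * of_int \<gamma>) *
        mask_poly B (((\<xi> + of_nat u * of_int \<gamma>) / of_int N ^ Suc n - of_nat u * of_int l0 / of_int N) + of_nat u * of_int l / of_int N)" for \<gamma> l
    proof -
      have 1: "\<xi> + of_nat u * of_int (f (\<gamma>, l)) = \<xi> + of_nat u * of_int \<gamma> + of_int (N ^ n * (int u * (l - l0)))"
        by (simp add: f_def algebra_simps)
      have 2: "(\<xi> + of_nat u * of_int \<gamma> + of_int (N ^ n * (int u * (l - l0)))) / of_int N ^ Suc n =
        ((\<xi> + of_nat u * of_int \<gamma>) / of_int N ^ Suc n - of_nat u * of_int l0 / of_int N) + of_nat u * of_int l / of_int N"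
        using N_ge2 by (simp add: add_divide_distrib diff_divide_distrib right_diff_distrib)
      show ?thesis unfolding ft_level_Suc 1 2 ft_level_periodic ..
    qed
    have "(\<Sum>\<gamma>\<in>f ` (\<Gamma> \<times> L). (cmod (ft_level (Suc n) (\<xi> + of_nat u * of_int \<gamma>)))\<^sup>2)
       = (\<Sum>p\<in>\<Gamma> \<times> L. (cmod (ft_level (Suc n) (\<xi> + of_nat u * of_int (f p))))\<^sup>2)"
      by (simp add: sum.reindex[OF inj])
    also have "\<dots> = (\<Sum>\<gamma>\<in>\<Gamma>. \<Sum>l\<in>L. (cmod (ft_level (Suc n) (\<xi> + of_nat u * of_int (f (\<gamma>, l)))))\<^sup>2)"
      by (subst sum.cartesian_product) (simp add: case_prod_beta)
    also have "\<dots> = (\<Sum>\<gamma>\<in>\<Gamma>. (cmod (ft_level n (\<xi> + of_nat u * of_int \<gamma>)))\<^sup>2)"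
      unfolding split norm_mult power_mult_distrib sum_distrib_left[symmetric]
      by (simp only: sum_norm_mask_poly_sq[OF u] mult_1_right)
    also have "\<dots> = 1" by (rule level_spectrum_sum[OF \<Gamma> u])
    finally show ?thesis .
  qed
  then show ?thesis
    unfolding level_spectrum_def using level_spectrum_finite[OF \<Gamma>] finite_L by (auto simp: f_def)
qed

lemma level_spectrum_extend:
  assumes "level_spectrum n \<Gamma>" "n \<le> m"
  shows "\<exists>\<Gamma>'. \<Gamma> \<subseteq> \<Gamma>' \<and> level_spectrum m \<Gamma>'"
  using assms(2)
proof (induction m rule: dec_induct)
  case base
  then show ?case using assms(1) by blast
next
  case (step m)
  then obtain \<Gamma>' where \<Gamma>': "\<Gamma> \<subseteq> \<Gamma>'" "level_spectrum m \<Gamma>'" by blast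
  obtain l0 where l0: "l0 \<in> L" using L_nonempty by blast
  have "\<Gamma> \<subseteq> (\<lambda>(\<gamma>, l). \<gamma> + N ^ m * (l - l0)) ` (\<Gamma>' \<times> L)"
    using \<Gamma>'(1) l0 by (auto intro!: rev_image_eqI[of "(_, l0)"])
  then show ?case using level_spectrum_Suc[OF \<Gamma>'(2)] by blast
qed

text \<open>Extend \<open>\<Gamma>\<close> to a high level \<open>m\<close> and move each new element within its class modulo \<open>N ^ m\<close>, to where
the tail of the infinite product is at least \<open>c\<close> for the multiplier \<open>u\<close>. The old elements stay: at
level \<open>m\<close> they have been scaled down to near \<open>0\<close>, where the tail is at least \<open>1 / 2\<close>.\<close>

lemma level_spectrum_step:
  assumes \<Gamma>: "level_spectrum n \<Gamma>" and c: "c \<le> 1 / 2"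
    and k: "\<And>y. \<exists>k::int. cmod (ft \<mu> (of_nat u * (y + of_int k))) \<ge> c"
  shows "\<exists>m \<Gamma>'. n < m \<and> \<Gamma> \<subseteq> \<Gamma>' \<and> level_spectrum m \<Gamma>' \<and>
    (\<forall>\<gamma>\<in>\<Gamma>'. cmod (ft \<mu> (of_nat u * of_int \<gamma> / of_int N ^ m)) \<ge> c)"
proof -
  define K where "K = 2 * pi * radius"
  define S where "S = (\<Sum>\<gamma>\<in>\<Gamma>. \<bar>of_int \<gamma>\<bar> :: real)"
  have N0: "(of_int N :: real) > 0" using N_ge2 by simp
  have K0: "K \<ge> 0" unfolding K_def using radius_nonneg by simp
  have fin: "finite \<Gamma>" using \<Gamma> by (rule level_spectrum_finite)
  obtain n0 where n0: "\<And>m. m \<ge> n0 \<Longrightarrow> \<bar>K * (of_nat u * S)\<bar> / of_int N ^ m < 1 / 2"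
    using exists_scale_small[of "1 / 2" "K * (of_nat u * S)"] by auto
  define m where "m = max n0 (Suc n)"
  have small: "cmod (ft \<mu> (of_nat u * of_int \<gamma> / of_int N ^ m)) \<ge> c" if "\<gamma> \<in> \<Gamma>" for \<gamma>
  proof -
    have "\<bar>of_int \<gamma>\<bar> \<le> S" unfolding S_def using fin that by (intro member_le_sum) auto
    then have "K * \<bar>of_nat u * of_int \<gamma> / of_int N ^ m\<bar> \<le> \<bar>K * (of_nat u * S)\<bar> / of_int N ^ m"
      using N0 K0 by (simp add: abs_mult divide_right_mono mult_left_mono)
    also have "\<dots> \<le> 1 / 2" using n0[of m] by (simp add: m_def)
    finally have "cmod (ft \<mu> (of_nat u * of_int \<gamma> / of_int N ^ m)) \<ge> 1 - 1 / 2"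
      unfolding K_def by (rule ft_near_1)
    then show ?thesis using c by simp
  qed
  obtain \<Gamma>1 where \<Gamma>1: "\<Gamma> \<subseteq> \<Gamma>1" "level_spectrum m \<Gamma>1"
    using level_spectrum_extend[OF \<Gamma>, of m] unfolding m_def
    by (metis Suc_leD max.cobounded2)
  \<comment> \<open>the displacement of \<open>\<gamma>\<close> within its class, zero on the old elements\<close>
  have "\<exists>k. cmod (ft \<mu> (of_nat u * of_int (\<gamma> + N ^ m * k) / of_int N ^ m)) \<ge> c \<and> (\<gamma> \<in> \<Gamma> \<longrightarrow> k = 0)" for \<gamma>
  proof (cases "\<gamma> \<in> \<Gamma>")
    case True
    then show ?thesis using small by (intro exI[of _ 0]) simp
  next
    case False
    obtain k where k: "cmod (ft \<mu> (of_nat u * (of_int \<gamma> / of_int N ^ m + of_int k))) \<ge> c"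
      using k by blast
    moreover have "of_nat u * (of_int \<gamma> / of_int N ^ m + of_int k) = of_nat u * of_int (\<gamma> + N ^ m * k) / (of_int N ^ m :: real)"
      using N0 by (simp add: field_simps)
    ultimately show ?thesis using False by (intro exI[of _ k]) (simp only: simp_thms)
  qed
  then obtain k where k: "\<And>\<gamma>. cmod (ft \<mu> (of_nat u * of_int (\<gamma> + N ^ m * k \<gamma>) / of_int N ^ m)) \<ge> c"
    "\<And>\<gamma>. \<gamma> \<in> \<Gamma> \<Longrightarrow> k \<gamma> = 0"
    by metis
  have "\<Gamma> \<subseteq> (\<lambda>\<gamma>. \<gamma> + N ^ m * k \<gamma>) ` \<Gamma>1"
    using \<Gamma>1(1) k(2) by force
  moreover have "n < m" by (simp add: m_def)
  ultimately show ?thesis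
    using level_spectrum_translate_classes[OF \<Gamma>1(2), of k] k(1) by blast
qed

end

context sparse_hadamard
begin

text \<open>Each step serves a single multiplier \<open>v j\<close>, and the sequence \<open>v\<close> takes every admissible value
infinitely often. This is enough, because for each multiplier the limit can be taken along the
subsequence of the steps devoted to it.\<close>

lemma exists_tower:
  "\<exists>n \<Gamma>. strict_mono n \<and> (\<forall>j. level_spectrum (n j) (\<Gamma> j) \<and> \<Gamma> j \<subseteq> \<Gamma> (Suc j)) \<and>
     (\<forall>u>0. coprime (int u) N \<longrightarrow>
        (\<exists>c>0. \<forall>j0. \<exists>j\<ge>j0. \<forall>\<gamma>\<in>\<Gamma> j. cmod (ft \<mu> (of_nat u * of_int \<gamma> / of_int N ^ n j)) \<ge> c))"
proof -
  have "\<exists>c>0. c \<le> 1 / 2 \<and> (u > 0 \<longrightarrow> coprime (int u) N \<longrightarrow>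
      (\<forall>y. \<exists>k::int. cmod (ft \<mu> (of_nat u * (y + of_int k))) \<ge> c))" for u
  proof (cases "u > 0 \<and> coprime (int u) N")
    case True
    then obtain c where "c > 0" "\<And>y. \<exists>k::int. cmod (ft \<mu> (of_nat u * (y + of_int k))) \<ge> c"
      using exists_uniform_lower_bound by blast
    then show ?thesis
      by (intro exI[of _ "min c (1 / 2)"]) (auto intro: min.coboundedI1)
  qed (auto intro: exI[of _ "1 / 2"])
  then obtain c where c: "\<And>u. c u > 0" "\<And>u. c u \<le> 1 / 2"
    "\<And>u y. u > 0 \<Longrightarrow> coprime (int u) N \<Longrightarrow> \<exists>k::int. cmod (ft \<mu> (of_nat u * (y + of_int k))) \<ge> c u"
    by metis
  \<comment> \<open>indices that do not decode to an admissible multiplier serve the multiplier \<open>1\<close>\<close>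
  define v where "v j = (let w = fst (prod_decode j) in if w > 0 \<and> coprime (int w) N then w else 1)" for j
  have v: "v j > 0" "coprime (int (v j)) N" for j
    by (auto simp: v_def Let_def)
  define P where "P = (\<lambda>(_::nat) (n, \<Gamma>). level_spectrum n \<Gamma>)"
  define Q where "Q = (\<lambda>j (n, \<Gamma>) (n', \<Gamma>'). n < n' \<and> \<Gamma> \<subseteq> \<Gamma>' \<and>
      (\<forall>\<gamma>\<in>\<Gamma>'. cmod (ft \<mu> (of_nat (v j) * of_int \<gamma> / of_int N ^ n')) \<ge> c (v j)))"
  have "\<exists>f. \<forall>j. P j (f j) \<and> Q j (f j) (f (Suc j))"
  proof (rule dependent_nat_choice)
    show "\<exists>x. P 0 x" using level_spectrum_singleton_0 by (auto simp: P_def)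
    fix x j assume "P j x"
    then have "level_spectrum (fst x) (snd x)" by (simp add: P_def case_prod_beta)
    from level_spectrum_step[OF this c(2)[of "v j"] c(3)[OF v]]
    obtain m \<Gamma>' where "fst x < m" "snd x \<subseteq> \<Gamma>'" "level_spectrum m \<Gamma>'"
      "\<forall>\<gamma>\<in>\<Gamma>'. cmod (ft \<mu> (of_nat (v j) * of_int \<gamma> / of_int N ^ m)) \<ge> c (v j)"
      by blast
    then show "\<exists>y. P (Suc j) y \<and> Q j x y"
      by (intro exI[of _ "(m, \<Gamma>')"]) (simp add: P_def Q_def case_prod_beta)
  qed
  then obtain f where f: "\<And>j. P j (f j)" "\<And>j. Q j (f j) (f (Suc j))" by blast
  define n \<Gamma> where "n j = fst (f j)" and "\<Gamma> j = snd (f j)" for j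
  have 1: "level_spectrum (n j) (\<Gamma> j)" for j
    using f(1)[of j] by (simp add: P_def n_def \<Gamma>_def case_prod_beta)
  have 2: "n j < n (Suc j)" "\<Gamma> j \<subseteq> \<Gamma> (Suc j)"
    "\<forall>\<gamma>\<in>\<Gamma> (Suc j). cmod (ft \<mu> (of_nat (v j) * of_int \<gamma> / of_int N ^ n (Suc j))) \<ge> c (v j)" for j
    using f(2)[of j] by (auto simp: Q_def n_def \<Gamma>_def case_prod_beta)
  have 3: "\<exists>j\<ge>j0. \<forall>\<gamma>\<in>\<Gamma> j. cmod (ft \<mu> (of_nat u * of_int \<gamma> / of_int N ^ n j)) \<ge> c u"
    if u: "u > 0" "coprime (int u) N" for u j0
  proof -
    let ?j = "prod_encode (u, j0)"
    have "v ?j = u" using u by (simp add: v_def)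
    moreover have "j0 \<le> Suc ?j" using le_prod_encode_2[of j0 u] by simp
    ultimately show ?thesis using 2(3)[of ?j] by (intro exI[of _ "Suc ?j"]) simp
  qed
  show ?thesis
  proof (intro exI[of _ n] exI[of _ \<Gamma>] conjI allI impI)
    show "strict_mono n" using 2(1) by (simp add: strict_mono_Suc_iff)
    show "level_spectrum (n j) (\<Gamma> j)" "\<Gamma> j \<subseteq> \<Gamma> (Suc j)" for j by (rule 1 2)+
    show "\<exists>c>0. \<forall>j0. \<exists>j\<ge>j0. \<forall>\<gamma>\<in>\<Gamma> j. cmod (ft \<mu> (of_nat u * of_int \<gamma> / of_int N ^ n j)) \<ge> c"
      if "u > 0" "coprime (int u) N" for u
      using c(1)[of u] 3[OF that] by (intro exI[of _ "c u"]) simp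
  qed
qed

text \<open>The union \<open>\<Lambda>\<close> of the tower satisfies Bessel's inequality since the finite levels do. Given \<open>\<xi>\<close>,
choose a finite \<open>F\<close> outside of which the squares contribute at most \<open>\<delta>\<close>. On a high level with the
lower bound \<open>c\<close> for the multiplier \<open>u\<close>, each square of \<open>ft_level\<close> exceeds that of \<open>ft \<mu>\<close> at most by
the factor \<open>4 / c\<^sup>2\<close>, so no more than \<open>\<delta> (4 / c\<^sup>2)\<close> of the total mass \<open>1\<close> of the level is outside
\<open>F\<close>. On \<open>F\<close>, \<open>ft_level\<close> converges to \<open>ft \<mu>\<close>.\<close>

theorem exists_simultaneous_parseval_set:
  "\<exists>\<Lambda>::int set. \<forall>u>0. coprime (int u) N \<longrightarrow>
    (\<forall>\<gamma>\<in>\<Lambda>. \<forall>\<gamma>'\<in>\<Lambda>. \<gamma> \<noteq> \<gamma>' \<longrightarrow> ft \<mu> (of_nat u * (of_int \<gamma> - of_int \<gamma>')) = 0) \<and>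
    (\<forall>\<xi>. \<forall>\<epsilon>>0. \<exists>F. finite F \<and> F \<subseteq> \<Lambda> \<and> (\<Sum>\<gamma>\<in>F. (cmod (ft \<mu> (\<xi> + of_nat u * of_int \<gamma>)))\<^sup>2) \<ge> 1 - \<epsilon>)"
proof -
  obtain n \<Gamma> where n: "strict_mono n" and \<Gamma>: "\<And>j. level_spectrum (n j) (\<Gamma> j)"
    and \<Gamma>_Suc: "\<And>j. \<Gamma> j \<subseteq> \<Gamma> (Suc j)"
    and low: "\<And>u. u > 0 \<Longrightarrow> coprime (int u) N \<Longrightarrow>
        \<exists>c>0. \<forall>j0. \<exists>j\<ge>j0. \<forall>\<gamma>\<in>\<Gamma> j. cmod (ft \<mu> (of_nat u * of_int \<gamma> / of_int N ^ n j)) \<ge> c"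
    using exists_tower by blast
  have mono: "\<Gamma> i \<subseteq> \<Gamma> j" if "i \<le> j" for i j
    using lift_Suc_mono_le[of \<Gamma>, OF \<Gamma>_Suc that] .
  define \<Lambda> where "\<Lambda> = (\<Union>j. \<Gamma> j)"
  have fin_sub: "\<exists>j. F \<subseteq> \<Gamma> j" if "finite F" "F \<subseteq> \<Lambda>" for F
    using that
  proof (induction F rule: finite_induct)
    case (insert x F)
    then obtain i j where "F \<subseteq> \<Gamma> i" "x \<in> \<Gamma> j" by (auto simp: \<Lambda>_def)
    then show ?case using mono[of i "max i j"] mono[of j "max i j"] by (intro exI[of _ "max i j"]) auto
  qed simp
  have orth: "ft \<mu> (of_nat u * (of_int \<gamma> - of_int \<gamma>')) = 0"
    if u: "coprime (int u) N" and \<gamma>: "\<gamma> \<in> \<Lambda>" "\<gamma>' \<in> \<Lambda>" "\<gamma> \<noteq> \<gamma>'" for u \<gamma> \<gamma>'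
  proof -
    obtain j where "\<gamma> \<in> \<Gamma> j" "\<gamma>' \<in> \<Gamma> j" using fin_sub[of "{\<gamma>, \<gamma>'}"] \<gamma> by auto
    then show ?thesis
      using level_spectrum_orthogonal[OF \<Gamma> u] \<gamma>(3)
      by (subst ft_eq_ft_level[of _ "n j"]) simp
  qed
  have parseval: "\<exists>F. finite F \<and> F \<subseteq> \<Lambda> \<and> (\<Sum>\<gamma>\<in>F. (cmod (ft \<mu> (\<xi> + of_nat u * of_int \<gamma>)))\<^sup>2) \<ge> 1 - \<epsilon>"
    if u: "u > 0" "coprime (int u) N" and \<epsilon>: "\<epsilon> > 0" for u \<xi> \<epsilon>
  proof -
    define g where "g \<gamma> = (cmod (ft \<mu> (\<xi> + of_nat u * of_int \<gamma>)))\<^sup>2" for \<gamma> :: int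
    define h where "h m \<gamma> = (cmod (ft_level m (\<xi> + of_nat u * of_int \<gamma>)))\<^sup>2" for m and \<gamma> :: int
    have g0: "g \<gamma> \<ge> 0" for \<gamma> by (simp add: g_def)
    have h_sum: "sum (h (n j)) (\<Gamma> j) = 1" for j
      unfolding h_def by (rule level_spectrum_sum[OF \<Gamma> u(2)])
    have bessel: "sum g F \<le> 1" if F: "finite F" "F \<subseteq> \<Lambda>" for F
    proof -
      obtain j where "F \<subseteq> \<Gamma> j" using fin_sub[OF F] by blast
      then have "sum g F \<le> sum g (\<Gamma> j)"
        using level_spectrum_finite[OF \<Gamma>] g0 by (intro sum_mono2) auto
      also have "\<dots> \<le> sum (h (n j)) (\<Gamma> j)"
        unfolding g_def h_def by (intro sum_mono power_mono norm_ft_le_ft_level) auto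
      finally show ?thesis by (simp add: h_sum)
    qed
    obtain c where c: "c > 0"
      "\<And>j0. \<exists>j\<ge>j0. \<forall>\<gamma>\<in>\<Gamma> j. cmod (ft \<mu> (of_nat u * of_int \<gamma> / of_int N ^ n j)) \<ge> c"
      using low[OF u] by blast
    define C where "C = 4 / c\<^sup>2"
    have C0: "C > 0" using c(1) by (simp add: C_def)
    define \<delta> where "\<delta> = \<epsilon> / (1 + C)"
    have \<delta>: "\<delta> > 0" "\<delta> * (1 + C) = \<epsilon>" using \<epsilon> C0 by (auto simp: \<delta>_def)
    define Fs where "Fs = {F. finite F \<and> F \<subseteq> \<Lambda>}"
    have bdd: "bdd_above (sum g ` Fs)"
      using bessel by (intro bdd_aboveI[of _ 1]) (auto simp: Fs_def)
    have ne: "Fs \<noteq> {}" by (auto simp: Fs_def)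
    obtain F where F: "F \<in> Fs" "(SUP F\<in>Fs. sum g F) - \<delta> < sum g F"
      using less_cSUP_iff[OF ne bdd, of "(SUP F\<in>Fs. sum g F) - \<delta>"] \<delta>(1) by auto
    have tail: "sum g G \<le> \<delta>" if "finite G" "G \<subseteq> \<Lambda>" "F \<inter> G = {}" for G
    proof -
      have "F \<union> G \<in> Fs" using that F(1) by (auto simp: Fs_def)
      then have "sum g (F \<union> G) \<le> (SUP F\<in>Fs. sum g F)" by (rule cSUP_upper[OF _ bdd])
      then show ?thesis using F that by (simp add: sum.union_disjoint Fs_def)
    qed
    have finF: "finite F" "F \<subseteq> \<Lambda>" using F(1) by (auto simp: Fs_def)
    obtain j0 where j0: "F \<subseteq> \<Gamma> j0" using fin_sub[OF finF] by blast
    have "(\<lambda>m. sum (h m) F) \<longlonglongrightarrow> sum g F"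
      unfolding h_def g_def by (intro tendsto_intros ft_level_tendsto)
    then have "\<forall>\<^sub>F m in sequentially. sum (h m) F < sum g F + \<delta>"
      using \<delta>(1) by (intro order_tendstoD) auto
    then obtain m0 where m0: "\<And>m. m \<ge> m0 \<Longrightarrow> sum (h m) F < sum g F + \<delta>"
      by (auto simp: eventually_sequentially)
    obtain m1 where m1: "\<And>m. m \<ge> m1 \<Longrightarrow> \<bar>2 * pi * radius * \<xi>\<bar> / of_int N ^ m < c / 2"
      using exists_scale_small[of "c / 2" "2 * pi * radius * \<xi>"] c(1) by auto
    obtain j where j: "j \<ge> max j0 (max m0 m1)"
      "\<And>\<gamma>. \<gamma> \<in> \<Gamma> j \<Longrightarrow> cmod (ft \<mu> (of_nat u * of_int \<gamma> / of_int N ^ n j)) \<ge> c"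
      using c(2)[of "max j0 (max m0 m1)"] by blast
    have nj: "n j \<ge> m0" "n j \<ge> m1" using j(1) strict_mono_imp_increasing[OF n, of j] by auto
    have hg: "h (n j) \<gamma> \<le> C * g \<gamma>" if "\<gamma> \<in> \<Gamma> j" for \<gamma>
    proof -
      let ?a = "of_nat u * of_int \<gamma> / of_int N ^ n j :: real"
      let ?b = "(\<xi> + of_nat u * of_int \<gamma>) / of_int N ^ n j :: real"
      have "cmod (ft \<mu> ?a - ft \<mu> ?b) \<le> 2 * pi * radius * \<bar>?a - ?b\<bar>" by (rule ft_lipschitz)
      also have "?a - ?b = - (\<xi> / of_int N ^ n j)" by (simp add: add_divide_distrib)
      also have "2 * pi * radius * \<bar>- (\<xi> / of_int N ^ n j)\<bar> = \<bar>2 * pi * radius * \<xi>\<bar> / of_int N ^ n j"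
        using radius_nonneg N_ge2 by (simp add: abs_mult)
      also have "\<dots> < c / 2" using m1[OF nj(2)] .
      finally have "cmod (ft \<mu> ?a - ft \<mu> ?b) < c / 2" .
      then have "c / 2 \<le> cmod (ft \<mu> ?b)"
        using j(2)[OF that] norm_triangle_ineq2[of "ft \<mu> ?a" "ft \<mu> ?b"] by simp
      then have "(c / 2)\<^sup>2 \<le> (cmod (ft \<mu> ?b))\<^sup>2"
        using c(1) by (intro power_mono) auto
      then have "h (n j) \<gamma> * (c / 2)\<^sup>2 \<le> h (n j) \<gamma> * (cmod (ft \<mu> ?b))\<^sup>2"
        by (intro mult_left_mono) (auto simp: h_def)
      also have "\<dots> = g \<gamma>"
        unfolding g_def h_def by (subst ft_eq_ft_level[of "\<xi> + of_nat u * of_int \<gamma>" "n j"])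
          (simp add: norm_mult power_mult_distrib)
      finally show ?thesis using c(1) by (simp add: C_def field_simps)
    qed
    have sub: "F \<subseteq> \<Gamma> j" using j0 mono[of j0 j] j(1) by auto
    have "1 = sum (h (n j)) F + sum (h (n j)) (\<Gamma> j - F)"
      using h_sum[of j] sum.subset_diff[OF sub level_spectrum_finite[OF \<Gamma>], of "h (n j)"] by simp
    also have "sum (h (n j)) (\<Gamma> j - F) \<le> C * sum g (\<Gamma> j - F)"
      unfolding sum_distrib_left by (intro sum_mono hg) auto
    also have "sum g (\<Gamma> j - F) \<le> \<delta>"
      using level_spectrum_finite[OF \<Gamma>] by (intro tail) (auto simp: \<Lambda>_def)
    finally have "1 \<le> sum g F + \<delta> + C * \<delta>"
      using m0[OF nj(1)] C0 by simp
    then have "sum g F \<ge> 1 - \<epsilon>" using \<delta>(2) by (simp add: algebra_simps)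
    then show ?thesis using finF unfolding g_def by blast
  qed
  show ?thesis
    by (rule exI[of _ \<Lambda>]) (intro allI impI conjI ballI; rule orth parseval; assumption)
qed

end

section \<open>From Parseval to a basis of \<open>L\<^sup>2\<close>\<close>

lemma L2_functionsD:
  assumes "f \<in> L2_functions M"
  shows "f \<in> borel_measurable M" "integrable M (\<lambda>x. (cmod (f x))\<^sup>2)"
  using assms by (simp_all add: L2_functions_def)

lemma norm_add_sq_le: "(cmod (a + b))\<^sup>2 \<le> 2 * (cmod a)\<^sup>2 + 2 * (cmod b)\<^sup>2"
proof -
  have "(cmod (a + b))\<^sup>2 \<le> (cmod a + cmod b)\<^sup>2"
    by (intro power_mono norm_triangle_ineq) auto
  also have "\<dots> \<le> 2 * (cmod a)\<^sup>2 + 2 * (cmod b)\<^sup>2"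
    using sum_squares_bound[of "cmod a" "cmod b"] by (simp add: power2_sum)
  finally show ?thesis .
qed

lemma L2_add:
  assumes f: "f \<in> L2_functions M" and g: "g \<in> L2_functions M"
  shows "(\<lambda>x. f x + g x) \<in> L2_functions M"
    and "(LINT x|M. (cmod (f x + g x))\<^sup>2) \<le> 2 * (LINT x|M. (cmod (f x))\<^sup>2) + 2 * (LINT x|M. (cmod (g x))\<^sup>2)"
proof -
  note [measurable] = L2_functionsD(1)[OF f] L2_functionsD(1)[OF g]
  have int: "integrable M (\<lambda>x. 2 * (cmod (f x))\<^sup>2 + 2 * (cmod (g x))\<^sup>2)"
    using L2_functionsD(2)[OF f] L2_functionsD(2)[OF g] by simp
  have i: "integrable M (\<lambda>x. (cmod (f x + g x))\<^sup>2)"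
    by (rule Bochner_Integration.integrable_bound[OF int]) (auto simp: norm_add_sq_le)
  then show "(\<lambda>x. f x + g x) \<in> L2_functions M" by (simp add: L2_functions_def)
  have "(LINT x|M. (cmod (f x + g x))\<^sup>2) \<le> (LINT x|M. 2 * (cmod (f x))\<^sup>2 + 2 * (cmod (g x))\<^sup>2)"
    by (intro integral_mono i int norm_add_sq_le)
  also have "\<dots> = 2 * (LINT x|M. (cmod (f x))\<^sup>2) + 2 * (LINT x|M. (cmod (g x))\<^sup>2)"
    using L2_functionsD(2)[OF f] L2_functionsD(2)[OF g] by simp
  finally show "(LINT x|M. (cmod (f x + g x))\<^sup>2) \<le> \<dots>" .
qed

lemma L2_scale: "f \<in> L2_functions M \<Longrightarrow> (\<lambda>x. c * f x) \<in> L2_functions M"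
  by (auto simp: L2_functions_def norm_mult power_mult_distrib)

lemma L2_diff:
  assumes "f \<in> L2_functions M" "g \<in> L2_functions M"
  shows "(\<lambda>x. f x - g x) \<in> L2_functions M"
  using L2_add(1)[OF assms(1) L2_scale[OF assms(2), of "-1"]] by simp

lemma (in finite_measure) L2_bounded:
  assumes "f \<in> borel_measurable M" "\<And>x. cmod (f x) \<le> C"
  shows "f \<in> L2_functions M"
proof -
  have "norm ((cmod (f x))\<^sup>2) \<le> C\<^sup>2" for x
    using assms(2)[of x] by (simp add: power_mono)
  then show ?thesis
    using assms(1) by (auto simp: L2_functions_def intro!: integrable_const_bound[of _ "C\<^sup>2"])
qed

definition trig_poly :: "real set \<Rightarrow> (real \<Rightarrow> complex) set" where
  "trig_poly \<Lambda> = {g. \<exists>F c. finite F \<and> F \<subseteq> \<Lambda> \<and> g = (\<lambda>x. \<Sum>t\<in>F. c t * exponential t x)}"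

lemma trig_poly_exponential: "t \<in> \<Lambda> \<Longrightarrow> (\<lambda>x. c * exponential t x) \<in> trig_poly \<Lambda>"
  unfolding trig_poly_def by (auto intro!: exI[of _ "{t}"] exI[of _ "\<lambda>_. c"])

lemma trig_poly_add:
  assumes "f \<in> trig_poly \<Lambda>" "g \<in> trig_poly \<Lambda>"
  shows "(\<lambda>x. f x + g x) \<in> trig_poly \<Lambda>"
proof -
  obtain F c where F: "finite F" "F \<subseteq> \<Lambda>" "f = (\<lambda>x. \<Sum>t\<in>F. c t * exponential t x)"
    using assms(1) by (auto simp: trig_poly_def)
  obtain G d where G: "finite G" "G \<subseteq> \<Lambda>" "g = (\<lambda>x. \<Sum>t\<in>G. d t * exponential t x)"
    using assms(2) by (auto simp: trig_poly_def)
  define c' d' where "c' t = (if t \<in> F then c t else 0)" and "d' t = (if t \<in> G then d t else 0)" for t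
  have 1: "f x = (\<Sum>t\<in>F \<union> G. c' t * exponential t x)" for x
    unfolding F(3) using F(1) G(1) by (intro sum.mono_neutral_cong_left) (auto simp: c'_def)
  have 2: "g x = (\<Sum>t\<in>F \<union> G. d' t * exponential t x)" for x
    unfolding G(3) using F(1) G(1) by (intro sum.mono_neutral_cong_left) (auto simp: d'_def)
  show ?thesis
    unfolding trig_poly_def using F(1,2) G(1,2)
    by (auto intro!: exI[of _ "F \<union> G"] exI[of _ "\<lambda>t. c' t + d' t"]
        simp: 1 2 sum.distrib distrib_right)
qed

lemma trig_poly_0: "(\<lambda>x. 0) \<in> trig_poly \<Lambda>"
  unfolding trig_poly_def by (auto intro!: exI[of _ "{}"])

lemma trig_poly_sum:
  "finite I \<Longrightarrow> (\<And>i. i \<in> I \<Longrightarrow> f i \<in> trig_poly \<Lambda>) \<Longrightarrow> (\<lambda>x. \<Sum>i\<in>I. f i x) \<in> trig_poly \<Lambda>"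
  by (induction I rule: finite_induct) (auto intro: trig_poly_0 trig_poly_add)

lemma trig_poly_scale:
  assumes "f \<in> trig_poly \<Lambda>"
  shows "(\<lambda>x. c * f x) \<in> trig_poly \<Lambda>"
proof -
  obtain F d where F: "finite F" "F \<subseteq> \<Lambda>" "f = (\<lambda>x. \<Sum>t\<in>F. d t * exponential t x)"
    using assms by (auto simp: trig_poly_def)
  have "(\<lambda>x. \<Sum>t\<in>F. (c * d t) * exponential t x) \<in> trig_poly \<Lambda>"
    using F by (intro trig_poly_sum trig_poly_exponential) auto
  then show ?thesis by (simp add: F(3) sum_distrib_left mult.assoc)
qed

lemma trig_poly_mult:
  assumes "f \<in> trig_poly UNIV" "g \<in> trig_poly UNIV"
  shows "(\<lambda>x. f x * g x) \<in> trig_poly UNIV"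
proof -
  obtain F c where F: "finite F" "f = (\<lambda>x. \<Sum>t\<in>F. c t * exponential t x)"
    using assms(1) by (auto simp: trig_poly_def)
  obtain G d where G: "finite G" "g = (\<lambda>x. \<Sum>t\<in>G. d t * exponential t x)"
    using assms(2) by (auto simp: trig_poly_def)
  have "(\<lambda>x. \<Sum>s\<in>F. \<Sum>t\<in>G. (c s * d t) * exponential (s + t) x) \<in> trig_poly UNIV"
    using F G by (intro trig_poly_sum trig_poly_exponential) auto
  then show ?thesis by (simp add: F(2) G(2) sum_product exponential_add mult_ac)
qed

lemma trig_poly_const: "(\<lambda>x. c) \<in> trig_poly UNIV"
  using trig_poly_exponential[of 0 UNIV c] by simp

text \<open>Real trigonometric polynomials that separate points, for the Stone-Weierstrass theorem.\<close>

lemma trig_poly_sine: "(\<lambda>x. complex_of_real (sin (2 * pi * s * (x - y)))) \<in> trig_poly UNIV"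
proof -
  have "complex_of_real (sin (2 * pi * s * (x - y))) =
      (exponential s (- y) / (2 * \<i>)) * exponential s x + (- exponential (- s) (- y) / (2 * \<i>)) * exponential (- s) x" for x
  proof -
    have "complex_of_real (sin \<theta>) = (cis \<theta> - cis (- \<theta>)) / (2 * \<i>)" for \<theta>
      by (simp add: complex_eq_iff Re_divide Im_divide power2_eq_square)
    then have "complex_of_real (sin (2 * pi * s * (x - y))) = (exponential s (x - y) - exponential (- s) (x - y)) / (2 * \<i>)"
      by (simp add: exponential_eq_cis)
    moreover have "exponential r (x - y) = exponential r (- y) * exponential r x" for r
      using exponential_add_right[of r "- y" x] by simp
    ultimately show ?thesis by (simp add: diff_divide_distrib right_diff_distrib mult.assoc)
  qed
  then show ?thesis by (simp only: trig_poly_add trig_poly_exponential UNIV_I)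
qed

lemma continuous_on_trig_poly: "f \<in> trig_poly \<Lambda> \<Longrightarrow> continuous_on UNIV f"
  by (auto simp: trig_poly_def exponential_def intro!: continuous_intros)

lemma continuous_approx_trig_poly:
  assumes "continuous_on {-R..R} f" "e > 0"
  shows "\<exists>g\<in>trig_poly UNIV. \<forall>x\<in>{-R..R}. cmod (complex_of_real (f x) - g x) < e"
proof -
  have "\<exists>g. (\<lambda>x. complex_of_real (g x)) \<in> trig_poly UNIV \<and> (\<forall>x\<in>{-R..R}. \<bar>f x - g x\<bar> < e)"
  proof (rule Stone_Weierstrass_HOL[OF compact_Icc])
    show "continuous_on {-R..R} g" if "(\<lambda>x. complex_of_real (g x)) \<in> trig_poly UNIV" for g :: "real \<Rightarrow> real"
    proof -
      have "continuous_on {-R..R} (\<lambda>x. Re (complex_of_real (g x)))"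
        by (intro continuous_intros continuous_on_subset[OF continuous_on_trig_poly[OF that]]) simp
      then show ?thesis by simp
    qed
    show "\<exists>g. (\<lambda>x. complex_of_real (g x)) \<in> trig_poly UNIV \<and> g x \<noteq> g y"
      if "x \<in> {-R..R} \<and> y \<in> {-R..R} \<and> x \<noteq> y" for x y
    proof -
      \<comment> \<open>a sine vanishing at \<open>y\<close> for which \<open>x\<close> is a quarter period away\<close>
      define s where "s = 1 / (4 * (x - y))"
      have quarter: "2 * pi * s * (x - y) = pi / 2" using that by (simp add: s_def field_simps)
      have nz: "sin (2 * pi * s * (x - y)) \<noteq> sin (2 * pi * s * (y - y))"
        unfolding quarter by simp
      show ?thesis
        by (rule exI[of _ "\<lambda>z. sin (2 * pi * s * (z - y))"], rule conjI, rule trig_poly_sine, rule nz)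
    qed
    fix g h :: "real \<Rightarrow> real"
    assume gh: "(\<lambda>x. complex_of_real (g x)) \<in> trig_poly UNIV \<and> (\<lambda>x. complex_of_real (h x)) \<in> trig_poly UNIV"
    show "(\<lambda>x. complex_of_real (g x + h x)) \<in> trig_poly UNIV"
      unfolding of_real_add by (rule trig_poly_add[OF conjunct1[OF gh] conjunct2[OF gh]])
    show "(\<lambda>x. complex_of_real (g x * h x)) \<in> trig_poly UNIV"
      unfolding of_real_mult by (rule trig_poly_mult[OF conjunct1[OF gh] conjunct2[OF gh]])
  qed (rule assms trig_poly_const)+
  then obtain g where g: "(\<lambda>x. complex_of_real (g x)) \<in> trig_poly UNIV" "\<And>x. x \<in> {-R..R} \<Longrightarrow> \<bar>f x - g x\<bar> < e"
    by blast
  have dist: "cmod (complex_of_real (f x) - complex_of_real (g x)) = \<bar>f x - g x\<bar>" for x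
    unfolding of_real_diff[symmetric] by (rule norm_of_real)
  show ?thesis
    by (rule bexI[OF _ g(1)], rule ballI, subst dist, rule g(2))
qed

text \<open>The \<open>L\<^sup>2\<close>-closure of the span of the exponentials with frequencies in \<open>\<Lambda>\<close>, expressed by the square
of the norm: for squares, the bound \<open>2 a\<^sup>2 + 2 b\<^sup>2\<close> of \<open>L2_add\<close> takes the place of Minkowski's inequality.\<close>

definition L2_closure :: "real measure \<Rightarrow> real set \<Rightarrow> (real \<Rightarrow> complex) set" where
  "L2_closure M \<Lambda> = {f \<in> L2_functions M. \<forall>\<epsilon>>0. \<exists>g\<in>trig_poly \<Lambda>. (LINT x|M. (cmod (f x - g x))\<^sup>2) < \<epsilon>}"

context real_distribution
begin

lemma measurable_trig_poly: "g \<in> trig_poly \<Lambda> \<Longrightarrow> g \<in> borel_measurable M"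
  by (auto simp: trig_poly_def)

lemma trig_poly_L2: "g \<in> trig_poly \<Lambda> \<Longrightarrow> g \<in> L2_functions M"
proof -
  assume g: "g \<in> trig_poly \<Lambda>"
  then obtain F c where F: "finite F" "g = (\<lambda>x. \<Sum>t\<in>F. c t * exponential t x)"
    by (auto simp: trig_poly_def)
  have "cmod (g x) \<le> (\<Sum>t\<in>F. cmod (c t))" for x
    unfolding F(2) by (rule order.trans[OF norm_sum]) (simp add: norm_mult)
  then show ?thesis using L2_bounded[OF measurable_trig_poly[OF g]] by blast
qed

lemma L2_closure_L2: "f \<in> L2_closure M \<Lambda> \<Longrightarrow> f \<in> L2_functions M"
  by (simp add: L2_closure_def)

lemma trig_poly_closure: "g \<in> trig_poly \<Lambda> \<Longrightarrow> g \<in> L2_closure M \<Lambda>"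
  unfolding L2_closure_def using trig_poly_L2 by (auto intro!: bexI[of _ g])

lemma L2_closure_limit:
  assumes f: "f \<in> L2_functions M"
    and approx: "\<And>\<epsilon>. \<epsilon> > 0 \<Longrightarrow> \<exists>g\<in>L2_closure M \<Lambda>. (LINT x|M. (cmod (f x - g x))\<^sup>2) < \<epsilon>"
  shows "f \<in> L2_closure M \<Lambda>"
  unfolding L2_closure_def
proof (intro CollectI conjI f allI impI)
  fix \<epsilon> :: real assume "\<epsilon> > 0"
  then obtain g where g: "g \<in> L2_closure M \<Lambda>" "(LINT x|M. (cmod (f x - g x))\<^sup>2) < \<epsilon> / 4"
    using approx[of "\<epsilon> / 4"] by auto
  then obtain h where h: "h \<in> trig_poly \<Lambda>" "(LINT x|M. (cmod (g x - h x))\<^sup>2) < \<epsilon> / 4"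
    using \<open>\<epsilon> > 0\<close> unfolding L2_closure_def by (auto dest!: spec[of _ "\<epsilon> / 4"])
  have "(LINT x|M. (cmod ((f x - g x) + (g x - h x)))\<^sup>2)
      \<le> 2 * (LINT x|M. (cmod (f x - g x))\<^sup>2) + 2 * (LINT x|M. (cmod (g x - h x))\<^sup>2)"
    using f L2_closure_L2[OF g(1)] trig_poly_L2[OF h(1)] by (intro L2_add(2) L2_diff)
  also have "\<dots> < \<epsilon>" using g(2) h(2) by simp
  finally show "\<exists>h\<in>trig_poly \<Lambda>. (LINT x|M. (cmod (f x - h x))\<^sup>2) < \<epsilon>"
    using h(1) by auto
qed

lemma L2_closure_add:
  assumes f: "f \<in> L2_closure M \<Lambda>" and g: "g \<in> L2_closure M \<Lambda>"
  shows "(\<lambda>x. f x + g x) \<in> L2_closure M \<Lambda>"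
  unfolding L2_closure_def
proof (intro CollectI conjI allI impI)
  show "(\<lambda>x. f x + g x) \<in> L2_functions M"
    using f g by (intro L2_add(1) L2_closure_L2)
  fix \<epsilon> :: real assume "\<epsilon> > 0"
  then obtain f' g' where h: "f' \<in> trig_poly \<Lambda>" "(LINT x|M. (cmod (f x - f' x))\<^sup>2) < \<epsilon> / 4"
      "g' \<in> trig_poly \<Lambda>" "(LINT x|M. (cmod (g x - g' x))\<^sup>2) < \<epsilon> / 4"
    using f g unfolding L2_closure_def by (auto dest!: spec[of _ "\<epsilon> / 4"])
  have "(LINT x|M. (cmod ((f x - f' x) + (g x - g' x)))\<^sup>2)
      \<le> 2 * (LINT x|M. (cmod (f x - f' x))\<^sup>2) + 2 * (LINT x|M. (cmod (g x - g' x))\<^sup>2)"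
    using f g h(1,3) by (intro L2_add(2) L2_diff L2_closure_L2 trig_poly_L2)
  also have "\<dots> < \<epsilon>" using h(2,4) by simp
  finally show "\<exists>h\<in>trig_poly \<Lambda>. (LINT x|M. (cmod (f x + g x - h x))\<^sup>2) < \<epsilon>"
    using trig_poly_add[OF h(1,3)] by (intro bexI[of _ "\<lambda>x. f' x + g' x"]) (simp_all add: algebra_simps)
qed

lemma L2_closure_scale:
  assumes f: "f \<in> L2_closure M \<Lambda>"
  shows "(\<lambda>x. c * f x) \<in> L2_closure M \<Lambda>"
proof (cases "c = 0")
  case True
  then show ?thesis using trig_poly_closure[OF trig_poly_0] by simp
next
  case False
  show ?thesis
    unfolding L2_closure_def
  proof (intro CollectI conjI allI impI)
    show "(\<lambda>x. c * f x) \<in> L2_functions M" by (rule L2_scale[OF L2_closure_L2[OF f]])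
    fix \<epsilon> :: real assume "\<epsilon> > 0"
    then have "\<epsilon> / (cmod c)\<^sup>2 > 0" using False by simp
    then obtain g where g: "g \<in> trig_poly \<Lambda>" "(LINT x|M. (cmod (f x - g x))\<^sup>2) < \<epsilon> / (cmod c)\<^sup>2"
      using f unfolding L2_closure_def by blast
    have "(LINT x|M. (cmod (c * f x - c * g x))\<^sup>2) = (cmod c)\<^sup>2 * (LINT x|M. (cmod (f x - g x))\<^sup>2)"
      by (simp add: right_diff_distrib[symmetric] norm_mult power_mult_distrib)
    also have "\<dots> < \<epsilon>" using g(2) False by (simp add: field_simps)
    finally show "\<exists>h\<in>trig_poly \<Lambda>. (LINT x|M. (cmod (c * f x - h x))\<^sup>2) < \<epsilon>"
      using trig_poly_scale[OF g(1)] by (intro bexI[of _ "\<lambda>x. c * g x"])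
  qed
qed

lemma L2_closure_sum:
  "finite I \<Longrightarrow> (\<And>i. i \<in> I \<Longrightarrow> f i \<in> L2_closure M \<Lambda>) \<Longrightarrow> (\<lambda>x. \<Sum>i\<in>I. f i x) \<in> L2_closure M \<Lambda>"
proof (induction I rule: finite_induct)
  case empty
  then show ?case using trig_poly_closure[OF trig_poly_0] by simp
qed (simp add: L2_closure_add)

lemma L2_closure_dominated_limit:
  assumes s: "\<And>i. s i \<in> L2_closure M \<Lambda>" and f: "f \<in> borel_measurable M"
    and lim: "\<And>x. (\<lambda>i. s i x) \<longlonglongrightarrow> f x"
    and dom: "\<And>i x. (cmod (f x - s i x))\<^sup>2 \<le> w x" "integrable M w"
  shows "f \<in> L2_closure M \<Lambda>"
proof (rule L2_closure_limit)
  note [measurable] = f L2_functionsD(1)[OF L2_closure_L2[OF s]]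
  have "(\<lambda>x. f x - s 0 x) \<in> L2_functions M"
  proof -
    have "integrable M (\<lambda>x. (cmod (f x - s 0 x))\<^sup>2)"
    proof (rule Bochner_Integration.integrable_bound[OF dom(2)])
      show "AE x in M. norm ((cmod (f x - s 0 x))\<^sup>2) \<le> norm (w x)"
        using order.trans[OF dom(1) abs_ge_self] by (intro AE_I2) simp
    qed simp
    then show ?thesis by (simp add: L2_functions_def)
  qed
  from L2_add(1)[OF this L2_closure_L2[OF s[of 0]]] show "f \<in> L2_functions M" by simp
  have "(\<lambda>i. LINT x|M. (cmod (f x - s i x))\<^sup>2) \<longlonglongrightarrow> (LINT x|M. 0)"
  proof (rule integral_dominated_convergence[where w = w])
    show "AE x in M. (\<lambda>i. (cmod (f x - s i x))\<^sup>2) \<longlonglongrightarrow> 0"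
    proof (rule AE_I2)
      fix x
      have "(\<lambda>i. (cmod (f x - s i x))\<^sup>2) \<longlonglongrightarrow> (cmod (f x - f x))\<^sup>2"
        by (intro tendsto_intros lim)
      then show "(\<lambda>i. (cmod (f x - s i x))\<^sup>2) \<longlonglongrightarrow> 0" by simp
    qed
  qed (use dom in auto)
  then have lim0: "(\<lambda>i. LINT x|M. (cmod (f x - s i x))\<^sup>2) \<longlonglongrightarrow> 0" by simp
  fix \<epsilon> :: real assume "\<epsilon> > 0"
  then have "\<forall>\<^sub>F i in sequentially. (LINT x|M. (cmod (f x - s i x))\<^sup>2) < \<epsilon>"
    using lim0 by (rule order_tendstoD(2)[rotated])
  then obtain i where "(LINT x|M. (cmod (f x - s i x))\<^sup>2) < \<epsilon>"
    by (auto simp: eventually_sequentially)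
  then show "\<exists>g\<in>L2_closure M \<Lambda>. (LINT x|M. (cmod (f x - g x))\<^sup>2) < \<epsilon>" using s by blast
qed

text \<open>If all exponentials are in the closure, so are bounded continuous functions by Stone-Weierstrass on
the support, indicators of half-lines as limits of continuous functions, indicators of Borel sets by
Dynkin's lemma, simple functions, and finally all of \<open>L\<^sup>2\<close>.\<close>

lemma L2_closure_all:
  assumes supp: "AE x in M. \<bar>x\<bar> \<le> R"
    and exps: "\<And>t. exponential t \<in> L2_closure M \<Lambda>"
    and f: "f \<in> L2_functions M"
  shows "f \<in> L2_closure M \<Lambda>"
proof -
  have trig: "g \<in> L2_closure M \<Lambda>" if g: "g \<in> trig_poly UNIV" for g
  proof -
    obtain F c where F: "finite F" "g = (\<lambda>x. \<Sum>t\<in>F. c t * exponential t x)"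
      using g by (auto simp: trig_poly_def)
    show ?thesis unfolding F(2) by (intro L2_closure_sum[OF F(1)] L2_closure_scale exps)
  qed
  have cont: "(\<lambda>x. complex_of_real (g x)) \<in> L2_closure M \<Lambda>"
    if g: "continuous_on UNIV g" "\<And>x. \<bar>g x\<bar> \<le> C" for g C
  proof (rule L2_closure_limit)
    have [measurable]: "g \<in> borel_measurable borel" using g(1) by (rule borel_measurable_continuous_onI)
    show L2: "(\<lambda>x. complex_of_real (g x)) \<in> L2_functions M"
      using g(2) by (intro L2_bounded[of _ C]) auto
    fix \<epsilon> :: real assume \<epsilon>: "\<epsilon> > 0"
    define e where "e = sqrt (\<epsilon> / 2)"
    have e: "e > 0" "e\<^sup>2 < \<epsilon>" using \<epsilon> by (simp_all add: e_def)
    obtain h where h: "h \<in> trig_poly UNIV" "\<And>x. x \<in> {-R..R} \<Longrightarrow> cmod (complex_of_real (g x) - h x) < e"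
      using continuous_approx_trig_poly[OF continuous_on_subset[OF g(1) subset_UNIV] e(1)] by blast
    have "(LINT x|M. (cmod (complex_of_real (g x) - h x))\<^sup>2) \<le> (LINT x|M. e\<^sup>2)"
    proof (rule integral_mono_AE)
      show "integrable M (\<lambda>x. (cmod (complex_of_real (g x) - h x))\<^sup>2)"
        using L2_functionsD(2)[OF L2_diff[OF L2 trig_poly_L2[OF h(1)]]] .
      show "AE x in M. (cmod (complex_of_real (g x) - h x))\<^sup>2 \<le> e\<^sup>2"
        using supp
      proof eventually_elim
        case (elim x)
        then have "x \<in> {-R..R}" by auto
        from less_imp_le[OF h(2)[OF this]] show ?case by (intro power_mono) auto
      qed
    qed simp
    also have "\<dots> = e\<^sup>2" by (simp add: prob_space del: space_eq_univ)
    finally show "\<exists>h\<in>L2_closure M \<Lambda>. (LINT x|M. (cmod (complex_of_real (g x) - h x))\<^sup>2) < \<epsilon>"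
      using trig[OF h(1)] e(2) by (intro bexI[of _ h]) auto
  qed
  have atMost: "(indicator {..a} :: real \<Rightarrow> complex) \<in> L2_closure M \<Lambda>" for a
  proof (rule L2_closure_dominated_limit[where w = "\<lambda>_. 1"])
    define s where "s i x = max 0 (min 1 (1 - real i * (x - a)))" for i :: nat and x
    have s01: "0 \<le> s i x" "s i x \<le> 1" for i x by (auto simp: s_def)
    show "(\<lambda>x. complex_of_real (s i x)) \<in> L2_closure M \<Lambda>" for i
      using s01 by (intro cont[of _ 1]) (auto simp: s_def intro!: continuous_intros)
    show "(cmod (indicator {..a} x - complex_of_real (s i x)))\<^sup>2 \<le> 1" for i x
    proof -
      have "indicator {..a} x - complex_of_real (s i x) = complex_of_real (indicator {..a} x - s i x)"
        by (simp add: indicator_def)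
      then have "cmod (indicator {..a} x - complex_of_real (s i x)) = \<bar>indicator {..a} x - s i x\<bar>"
        by (simp only: norm_of_real)
      also have "\<dots> \<le> 1" using s01[of i x] by (auto simp: indicator_def)
      finally show ?thesis by (simp add: power_le_one)
    qed
    show "(\<lambda>i. complex_of_real (s i x)) \<longlonglongrightarrow> indicator {..a} x" for x
    proof (cases "x \<le> a")
      case True
      then have "s i x = 1" for i by (simp add: s_def mult_nonneg_nonpos)
      then show ?thesis using True by simp
    next
      case False
      obtain n where n: "1 / (x - a) < real n" using reals_Archimedean2 by blast
      have "s i x = 0" if "i \<ge> n" for i
      proof -
        have "1 < real n * (x - a)" using n False by (simp add: divide_less_eq)
        also have "\<dots> \<le> real i * (x - a)" using that False by (intro mult_right_mono) auto
        finally show ?thesis by (simp add: s_def)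
      qed
      then have "\<forall>\<^sub>F i in sequentially. complex_of_real (s i x) = indicator {..a} x"
        using False by (auto simp: eventually_sequentially intro!: exI[of _ n])
      then show ?thesis by (rule tendsto_eventually)
    qed
  qed simp_all
  have ind: "(indicator A :: real \<Rightarrow> complex) \<in> L2_closure M \<Lambda>" if "A \<in> sets borel" for A
  proof -
    have "Int_stable (range (atMost :: real \<Rightarrow> real set))"
      by (auto simp: Int_stable_def)
    moreover have "range (atMost :: real \<Rightarrow> real set) \<subseteq> Pow UNIV" by simp
    moreover have "A \<in> sigma_sets UNIV (range atMost)"
      using that unfolding borel_eq_atMost by simp
    ultimately show ?thesis
    proof (induction rule: sigma_sets_induct_disjoint)
      case (basic A)
      then show ?case using atMost by auto
    next
      case empty
      then show ?case using trig_poly_closure[OF trig_poly_0] by (simp add: indicator_def)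
    next
      case (compl A)
      have "(\<lambda>x. 1 + (-1) * indicator A x) \<in> L2_closure M \<Lambda>"
        by (intro L2_closure_add L2_closure_scale compl trig trig_poly_const)
      moreover have "(\<lambda>x. 1 + (-1) * indicator A x :: complex) = indicator (UNIV - A)"
        by (auto simp: indicator_def)
      ultimately show ?case by simp
    next
      case (union A)
      have meas: "A i \<in> sets borel" for i using union(2) unfolding borel_eq_atMost by auto
      show ?case
      proof (rule L2_closure_dominated_limit[where w = "\<lambda>_. 1"])
        have "(\<lambda>x. \<Sum>i<n. indicator (A i) x :: complex) = indicator (\<Union>i<n. A i)" for n
          by (rule ext, rule indicator_UN_disjoint[symmetric])
             (use union(1) in \<open>auto simp: disjoint_family_on_def\<close>)
        then show "indicator (\<Union>i<n. A i) \<in> L2_closure M \<Lambda>" for n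
          using L2_closure_sum[of "{..<n}" "\<lambda>i. indicator (A i)" \<Lambda>] union(3) by simp
        show "(\<lambda>n. indicator (\<Union>i<n. A i) x :: complex) \<longlonglongrightarrow> indicator (\<Union>i. A i) x" for x
          by (rule LIMSEQ_indicator_UN)
        show "(indicator (\<Union>i. A i) :: real \<Rightarrow> complex) \<in> borel_measurable M"
          using meas by (intro borel_measurable_indicator) auto
        show "(cmod (indicator (\<Union>i. A i) x - indicator (\<Union>i<n. A i) x))\<^sup>2 \<le> 1" for n x
          by (auto simp: indicator_def)
      qed simp
    qed
  qed
  show ?thesis
  proof -
    note [measurable] = L2_functionsD(1)[OF f]
    obtain s where s: "\<And>i. simple_function M (s i)" "\<And>x. (\<lambda>i. s i x) \<longlonglongrightarrow> f x"
      "\<And>i x. dist (s i x) 0 \<le> 2 * dist (f x) 0"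
      using borel_measurable_implies_sequence_metric[OF L2_functionsD(1)[OF f], of 0] by auto
    show ?thesis
    \<comment> \<open>\<open>10 = 2 + 2 * 2\<^sup>2\<close>, since \<open>s i\<close> is bounded by \<open>2 * cmod (f x)\<close>\<close>
    proof (rule L2_closure_dominated_limit[where w = "\<lambda>x. 10 * (cmod (f x))\<^sup>2"])
      show "s i \<in> L2_closure M \<Lambda>" for i
      proof -
        have fin: "finite (range (s i))" using simple_functionD(1)[OF s(1)[of i]] by simp
        have expand: "s i x = (\<Sum>y\<in>range (s i). y * indicator (s i -` {y}) x)" for x
          using fin by (subst sum.remove[of _ "s i x"]) (auto simp: indicator_def)
        then have "(\<lambda>x. \<Sum>y\<in>range (s i). y * indicator (s i -` {y}) x) = s i"
          by (intro ext) (rule expand[symmetric])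
        moreover have "s i -` {y} \<in> sets borel" for y
          using simple_functionD(2)[OF s(1)[of i], of "{y}"] by simp
        then have "(\<lambda>x. \<Sum>y\<in>range (s i). y * indicator (s i -` {y}) x) \<in> L2_closure M \<Lambda>"
          by (intro L2_closure_sum[OF fin] L2_closure_scale ind)
        ultimately show ?thesis by (simp only:)
      qed
      show "(cmod (f x - s i x))\<^sup>2 \<le> 10 * (cmod (f x))\<^sup>2" for i x
      proof -
        have "(cmod (s i x))\<^sup>2 \<le> (2 * cmod (f x))\<^sup>2" using s(3)[of i x] by (intro power_mono) auto
        then show ?thesis using norm_add_sq_le[of "f x" "- s i x"] by (simp add: power_mult_distrib)
      qed
    qed (use s(2) L2_functionsD[OF f] in auto)
  qed
qed

lemma integral_exponential_cnj: "(LINT x|M. exponential s x * cnj (exponential t x)) = ft M (s - t)"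
  by (simp add: ft_def exponential_diff)

text \<open>The distance of an exponential to its orthogonal projection on the span of finitely many others.\<close>

lemma L2_dist_projection:
  assumes F: "finite F" and orth: "\<And>s t. s \<in> F \<Longrightarrow> t \<in> F \<Longrightarrow> s \<noteq> t \<Longrightarrow> ft M (s - t) = 0"
  shows "(LINT x|M. (cmod (exponential \<xi> x - (\<Sum>t\<in>F. ft M (\<xi> - t) * exponential t x)))\<^sup>2)
     = 1 - (\<Sum>t\<in>F. (cmod (ft M (\<xi> - t)))\<^sup>2)"
proof -
  define a where "a t = ft M (\<xi> - t)" for t
  define P where "P x = (\<Sum>t\<in>F. a t * exponential t x)" for x
  have ft0: "ft M 0 = 1" by (simp add: ft_eq_char char_zero)
  have ft_cnj: "ft M (t - \<xi>) = cnj (a t)" for t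
    unfolding a_def integral_exponential_cnj[symmetric] Bochner_Integration.integral_cnj[symmetric]
    by (simp add: mult.commute)
  have i: "integrable M (\<lambda>x. exponential s x * cnj (exponential t x))" for s t
    by (simp flip: exponential_diff)
  have i1: "integrable M (\<lambda>x. exponential \<xi> x * cnj (P x))"
    unfolding P_def cnj_sum complex_cnj_mult sum_distrib_left
    using i by (auto simp: mult.left_commute[of "exponential \<xi> x" for x])
  have i2: "integrable M (\<lambda>x. P x * cnj (exponential \<xi> x))"
    unfolding P_def sum_distrib_right mult.assoc using i by auto
  have PP: "P x * cnj (P x) = (\<Sum>s\<in>F. \<Sum>t\<in>F. (a s * cnj (a t)) * (exponential s x * cnj (exponential t x)))" for x
    unfolding P_def by (simp add: sum_product mult_ac)
  have i3: "integrable M (\<lambda>x. P x * cnj (P x))"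
    unfolding PP using i by auto
  have "complex_of_real (LINT x|M. (cmod (exponential \<xi> x - P x))\<^sup>2)
      = (LINT x|M. (exponential \<xi> x - P x) * cnj (exponential \<xi> x - P x))"
    by (simp only: complex_norm_square flip: integral_complex_of_real)
  also have "\<dots> = (LINT x|M. exponential \<xi> x * cnj (exponential \<xi> x) - exponential \<xi> x * cnj (P x)
      - P x * cnj (exponential \<xi> x) + P x * cnj (P x))"
    by (simp add: algebra_simps)
  also have "\<dots> = (LINT x|M. exponential \<xi> x * cnj (exponential \<xi> x)) - (LINT x|M. exponential \<xi> x * cnj (P x))
      - (LINT x|M. P x * cnj (exponential \<xi> x)) + (LINT x|M. P x * cnj (P x))"
    using i i1 i2 i3 by simp
  also have "(LINT x|M. exponential \<xi> x * cnj (exponential \<xi> x)) = 1"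
    by (simp add: integral_exponential_cnj ft0)
  also have "(LINT x|M. exponential \<xi> x * cnj (P x)) = (\<Sum>t\<in>F. cnj (a t) * a t)"
  proof -
    have "(LINT x|M. exponential \<xi> x * cnj (P x)) = (LINT x|M. (\<Sum>t\<in>F. cnj (a t) * (exponential \<xi> x * cnj (exponential t x))))"
      unfolding P_def by (simp add: sum_distrib_left mult_ac)
    also have "\<dots> = (\<Sum>t\<in>F. cnj (a t) * a t)"
      using i by (simp add: integral_exponential_cnj a_def)
    finally show ?thesis .
  qed
  also have "(LINT x|M. P x * cnj (exponential \<xi> x)) = (\<Sum>t\<in>F. a t * cnj (a t))"
    unfolding P_def sum_distrib_right mult.assoc
    using i by (simp add: integral_exponential_cnj ft_cnj)
  also have "(LINT x|M. P x * cnj (P x)) = (\<Sum>t\<in>F. a t * cnj (a t))"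
  proof -
    have "(LINT x|M. P x * cnj (P x)) = (\<Sum>s\<in>F. \<Sum>t\<in>F. (a s * cnj (a t)) * ft M (s - t))"
      unfolding PP using i by (simp add: integral_exponential_cnj)
    also have "\<dots> = (\<Sum>s\<in>F. \<Sum>t\<in>F. if s = t then a s * cnj (a t) else 0)"
      using orth by (intro sum.cong refl) (auto simp: ft0)
    also have "\<dots> = (\<Sum>t\<in>F. a t * cnj (a t))" using F by simp
    finally show ?thesis .
  qed
  also have "1 - (\<Sum>t\<in>F. cnj (a t) * a t) - (\<Sum>t\<in>F. a t * cnj (a t)) + (\<Sum>t\<in>F. a t * cnj (a t))
      = complex_of_real (1 - (\<Sum>t\<in>F. (cmod (a t))\<^sup>2))"
    unfolding of_real_diff of_real_sum complex_norm_square by (simp add: mult.commute)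
  finally show ?thesis unfolding P_def a_def by (simp only: of_real_eq_iff)
qed

text \<open>The criterion of Jorgensen and Pedersen: Parseval's identity for exponentials puts every exponential
into the closed span of the orthonormal system, and exponentials span a dense subspace.\<close>

theorem is_spectrum_if_parseval:
  assumes supp: "AE x in M. \<bar>x\<bar> \<le> R"
    and orth: "\<And>s t. s \<in> \<Lambda> \<Longrightarrow> t \<in> \<Lambda> \<Longrightarrow> s \<noteq> t \<Longrightarrow> ft M (s - t) = 0"
    and parseval: "\<And>\<xi> \<epsilon>. \<epsilon> > 0 \<Longrightarrow> \<exists>F. finite F \<and> F \<subseteq> \<Lambda> \<and> (\<Sum>t\<in>F. (cmod (ft M (\<xi> - t)))\<^sup>2) \<ge> 1 - \<epsilon>"
  shows "is_spectrum M \<Lambda>"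
proof -
  have ft0: "ft M 0 = 1" by (simp add: ft_eq_char char_zero)
  have inner: "L2_inner M (exponential s) (exponential t) = ft M (s - t)" for s t
    by (simp add: L2_inner_def integral_exponential_cnj)
  have inj: "inj_on exponential \<Lambda>"
  proof (rule inj_onI, rule ccontr)
    fix s t assume st: "s \<in> \<Lambda>" "t \<in> \<Lambda>" "exponential s = exponential t" "s \<noteq> t"
    then have "ft M (s - t) = ft M (t - t)" by (metis inner)
    then show False using orth[of s t] st by (simp add: ft0)
  qed
  have exps: "exponential \<xi> \<in> L2_closure M \<Lambda>" for \<xi>
    unfolding L2_closure_def
  proof (intro CollectI conjI allI impI)
    show "exponential \<xi> \<in> L2_functions M" by (rule L2_bounded[of _ 1]) simp_all
    fix \<epsilon> :: real assume "\<epsilon> > 0"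
    then obtain F where F: "finite F" "F \<subseteq> \<Lambda>" "(\<Sum>t\<in>F. (cmod (ft M (\<xi> - t)))\<^sup>2) \<ge> 1 - \<epsilon> / 2"
      using parseval[of "\<epsilon> / 2"] by auto
    have "(LINT x|M. (cmod (exponential \<xi> x - (\<Sum>t\<in>F. ft M (\<xi> - t) * exponential t x)))\<^sup>2)
        = 1 - (\<Sum>t\<in>F. (cmod (ft M (\<xi> - t)))\<^sup>2)"
      using F(2) by (intro L2_dist_projection F(1) orth) auto
    also have "\<dots> < \<epsilon>" using F(3) \<open>\<epsilon> > 0\<close> by simp
    finally show "\<exists>g\<in>trig_poly \<Lambda>. (LINT x|M. (cmod (exponential \<xi> x - g x))\<^sup>2) < \<epsilon>"
      using F(1,2)
      by (intro bexI[of _ "\<lambda>x. \<Sum>t\<in>F. ft M (\<xi> - t) * exponential t x"] trig_poly_sum trig_poly_exponential) auto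
  qed
  show ?thesis
    unfolding is_spectrum_def L2_orthonormal_basis_def
  proof (intro conjI ballI allI impI)
    show "exponential ` \<Lambda> \<subseteq> L2_functions M"
      using exps L2_closure_L2 by auto
    show "L2_inner M f g = (if f = g then 1 else 0)" if fg: "f \<in> exponential ` \<Lambda>" "g \<in> exponential ` \<Lambda>" for f g
    proof -
      obtain s t where st: "s \<in> \<Lambda>" "t \<in> \<Lambda>" "f = exponential s" "g = exponential t"
        using fg by blast
      then show ?thesis using orth[of s t] inj by (auto simp: inner ft0 inj_on_eq_iff)
    qed
    fix f \<epsilon> assume f: "f \<in> L2_functions M" and \<epsilon>: "(\<epsilon>::real) > 0"
    have "f \<in> L2_closure M \<Lambda>" by (rule L2_closure_all[OF supp exps f])
    moreover have "\<epsilon>\<^sup>2 > 0" using \<epsilon> by simp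
    ultimately obtain g where "g \<in> trig_poly \<Lambda>" and g: "(LINT x|M. (cmod (f x - g x))\<^sup>2) < \<epsilon>\<^sup>2"
      unfolding L2_closure_def by blast
    then obtain F c where F: "finite F" "F \<subseteq> \<Lambda>" "g = (\<lambda>x. \<Sum>t\<in>F. c t * exponential t x)"
      unfolding trig_poly_def by blast
    define d where "d h = c (the_inv_into \<Lambda> exponential h)" for h
    have injF: "inj_on exponential F" using inj F(2) by (rule inj_on_subset)
    have "(\<Sum>h\<in>exponential ` F. d h * h x) = g x" for x
      unfolding F(3) sum.reindex[OF injF] o_def
      using F(2) by (intro sum.cong refl) (auto simp: d_def the_inv_into_f_f[OF inj])
    then have "L2_norm M (\<lambda>x. f x - (\<Sum>h\<in>exponential ` F. d h * h x)) = sqrt (LINT x|M. (cmod (f x - g x))\<^sup>2)"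
      by (simp add: L2_norm_def)
    also have "\<dots> < sqrt (\<epsilon>\<^sup>2)" using g by (rule real_sqrt_less_mono)
    also have "\<dots> = \<epsilon>" using \<epsilon> by simp
    finally show "\<exists>F c. finite F \<and> F \<subseteq> exponential ` \<Lambda> \<and> L2_norm M (\<lambda>x. f x - (\<Sum>g\<in>F. c g * g x)) < \<epsilon>"
      using F(1,2) by (intro exI[of _ "exponential ` F"] exI[of _ d]) auto
  qed
qed

end

section \<open>Simultaneous spectra of the self-similar measure\<close>

lemma norm_ft_minus: "cmod (ft \<nu> (- t)) = cmod (ft \<nu> t)"
proof -
  have "ft \<nu> (- t) = cnj (ft \<nu> t)"
    unfolding ft_def cnj_exponential[symmetric] by (rule Bochner_Integration.integral_cnj)
  then show ?thesis by simp
qed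

context sparse_hadamard
begin

text \<open>One set serves all positive multipliers prime to \<open>N\<close>, not only the products of powers of finitely many
given integers.\<close>

theorem exists_simultaneous_spectrum:
  "\<exists>\<Lambda> :: int set. \<forall>u>0. coprime (int u) N \<longrightarrow>
     is_spectrum \<mu> ((\<lambda>x. of_nat u * x) ` of_int ` \<Lambda>)"
proof -
  obtain \<Lambda> :: "int set" where
    orth: "\<And>u \<gamma> \<gamma>'. u > 0 \<Longrightarrow> coprime (int u) N \<Longrightarrow> \<gamma> \<in> \<Lambda> \<Longrightarrow> \<gamma>' \<in> \<Lambda> \<Longrightarrow> \<gamma> \<noteq> \<gamma>' \<Longrightarrow>
        ft \<mu> (of_nat u * (of_int \<gamma> - of_int \<gamma>')) = 0" and
    parseval: "\<And>u \<xi> \<epsilon>. u > 0 \<Longrightarrow> coprime (int u) N \<Longrightarrow> \<epsilon> > 0 \<Longrightarrow>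
        \<exists>F. finite F \<and> F \<subseteq> \<Lambda> \<and> (\<Sum>\<gamma>\<in>F. (cmod (ft \<mu> (\<xi> + of_nat u * of_int \<gamma>)))\<^sup>2) \<ge> 1 - \<epsilon>"
    using exists_simultaneous_parseval_set by metis
  have "is_spectrum \<mu> ((\<lambda>x. of_nat u * x) ` of_int ` \<Lambda>)"
    if u: "u > 0" "coprime (int u) N" for u
  proof (rule \<mu>.is_spectrum_if_parseval[OF AE_abs_le_radius])
    fix s t :: real assume st: "s \<in> (\<lambda>x. of_nat u * x) ` of_int ` \<Lambda>" "t \<in> (\<lambda>x. of_nat u * x) ` of_int ` \<Lambda>" "s \<noteq> t"
    then obtain \<gamma> \<gamma>' where "\<gamma> \<in> \<Lambda>" "\<gamma>' \<in> \<Lambda>" "s = of_nat u * of_int \<gamma>" "t = of_nat u * of_int \<gamma>'"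
      by auto
    then show "ft \<mu> (s - t) = 0"
      using orth[OF u, of \<gamma> \<gamma>'] st(3) by (auto simp: right_diff_distrib)
  next
    fix \<xi> \<epsilon> :: real assume "\<epsilon> > 0"
    then obtain F where F: "finite F" "F \<subseteq> \<Lambda>"
      "(\<Sum>\<gamma>\<in>F. (cmod (ft \<mu> (- \<xi> + of_nat u * of_int \<gamma>)))\<^sup>2) \<ge> 1 - \<epsilon>"
      using parseval[OF u, of \<epsilon> "- \<xi>"] by blast
    have inj: "inj_on (\<lambda>\<gamma>. of_nat u * of_int \<gamma> :: real) F"
      using u(1) by (simp add: inj_on_def)
    have "cmod (ft \<mu> (- \<xi> + of_nat u * of_int \<gamma>)) = cmod (ft \<mu> (\<xi> - of_nat u * of_int \<gamma>))" for \<gamma>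
      using norm_ft_minus[of \<mu> "\<xi> - of_nat u * of_int \<gamma>"] by simp
    then have "(\<Sum>t\<in>(\<lambda>\<gamma>. of_nat u * of_int \<gamma>) ` F. (cmod (ft \<mu> (\<xi> - t)))\<^sup>2) \<ge> 1 - \<epsilon>"
      using F(3) by (simp add: sum.reindex[OF inj])
    then show "\<exists>F. finite F \<and> F \<subseteq> (\<lambda>x. of_nat u * x) ` of_int ` \<Lambda> \<and>
        (\<Sum>t\<in>F. (cmod (ft \<mu> (\<xi> - t)))\<^sup>2) \<ge> 1 - \<epsilon>"
      using F(1,2) by (intro exI[of _ "(\<lambda>\<gamma>. of_nat u * of_int \<gamma>) ` F"]) auto
  qed
  then show ?thesis by blast
qed

end

theorem theorem1p5:
  fixes N :: int and B L :: "int set" and k :: nat and p :: "nat \<Rightarrow> int"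
  assumes "hadamard_triple N B L"
    and "int (card B) < N"
    and "k \<ge> 1"
    and "\<forall>i\<in>{1..k}. p i \<ge> 2"
    and "gcd (\<Prod>i=1..k. p i) N = 1"
  shows "\<exists>\<Lambda> :: real set. \<forall>n :: nat \<Rightarrow> nat.
           is_spectrum (self_similar_measure N B)
             ((\<lambda>x. (\<Prod>i=1..k. real_of_int (p i) ^ n i) * x) ` \<Lambda>)"
proof -
  interpret sparse_hadamard N B L
    using assms(1,2) by unfold_locales
  obtain \<Lambda> :: "int set" where \<Lambda>: "\<And>u. u > 0 \<Longrightarrow> coprime (int u) N \<Longrightarrow>
      is_spectrum (self_similar_measure N B) ((\<lambda>x. of_nat u * x) ` of_int ` \<Lambda>)"
    using exists_simultaneous_spectrum by blast
  have "is_spectrum (self_similar_measure N B)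
      ((\<lambda>x. (\<Prod>i=1..k. real_of_int (p i) ^ n i) * x) ` of_int ` \<Lambda>)" for n
  proof -
    define u where "u = (\<Prod>i=1..k. nat (p i) ^ n i)"
    have pos: "p i > 0" if "i \<in> {1..k}" for i
      using bspec[OF assms(4) that] by simp
    have "u > 0" unfolding u_def using pos by (intro prod_pos ballI zero_less_power) simp
    have int_u: "int u = (\<Prod>i=1..k. p i ^ n i)"
      unfolding u_def of_nat_prod by (intro prod.cong refl) (use pos in \<open>simp add: less_imp_le\<close>)
    have "coprime (p i) N" if "i \<in> {1..k}" for i
    proof (rule coprime_divisors)
      show "p i dvd (\<Prod>i=1..k. p i)" using that by (intro dvd_prodI) auto
      show "coprime (\<Prod>i=1..k. p i) N" using assms(5) by (simp add: coprime_iff_gcd_eq_1)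
    qed simp
    then have "coprime (int u) N"
      unfolding int_u by (intro prod_coprime_left) simp
    moreover have "real u = (\<Prod>i=1..k. real_of_int (p i) ^ n i)"
      using int_u by (metis (mono_tags, lifting) of_int_of_nat_eq of_int_power of_int_prod prod.cong)
    ultimately show ?thesis using \<Lambda>[of u] \<open>u > 0\<close> by simp
  qed
  then show ?thesis by blast
qed

end
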